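(* Fix $\epsilon>0$, integers $m,r\ge 2$, and an integer $k$ with $1\le k\le m/2$. Let $G\le S_m\wr S_r$ be a primitive non-elemental permutation group of type $(r,m,k)$, i.e. a subgroup of $S_m\wr S_r$ acting transitively on $\Omega^P(m,r,k)=\binom{[m]}{k}^r$ via the primitive action. Then $$\left|B(H;G,\Omega^P(m,r,k))\right|\ll H^{r\left(\binom{m}{k}+r-1\right)+1+\epsilon}.$$
   Context: Polynomials: the height of $f=\sum_i a_ix^i\in\mathbb{Z}[x]$ is $H(f)=\max_i|a_i|$. For $n\in\mathbb{N}$ and real $H\ge 1$, $B_n(H)=\{f\in\mathbb{Z}[x]: f\text{ monic},\ \deg f=n,\ H(f)\le H\}$. For separable $f$, $\Omega_f=\{\alpha\in\mathbb{C}:f(\alpha)=0\}$ and $G_f=\mathrm{Gal}(\mathbb{Q}(\Omega_f)/\mathbb{Q})$, which acts naturally (faithfully) on $\Omega_f$. A permutation group $(G,\Omega)$ is a finite group $G$ with a faithful action on a finite set $\Omega$; an isomorphism $(G_1,\Omega_1)\cong(G_2,\Omega_2)$ is a pair $(\varphi,\varphi^* )$ of a group isomorphism $\varphi:G_1\to G_2$ and a bijection $\varphi^*:\Omega_1\to\Omega_2$ with $\varphi(\sigma)(\varphi^*(\omega))=\varphi^*(\sigma(\omega))$ for all $\sigma\in G_1,\omega\in\Omega_1$. Set $B(H;G,\Omega)=\{f\in B_{|\Omega|}(H): f\text{ separable},\ (G_f,\Omega_f)\cong(G,\Omega)\}$. The notation $X\ll Y$ means that $X\le CY$ for all $H\ge1$,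 with $C>0$ independent of $H$ (it may depend on all the other fixed data). Groups: $[m]=\{1,\dots,m\}$; $\binom{[m]}{k}$ is the set of $k$-element subsets of $[m]$, on which $S_m$ acts naturally, and $\binom{[m]}{k}^r$ is the set of $r$-tuples of such subsets. The wreath product $S_m\wr S_r=S_m^r\rtimes S_r$ is formed with respect to the action $\rho\cdot(\tau_1,\dots,\tau_r)=(\tau_{\rho^{-1}(1)},\dots,\tau_{\rho^{-1}(r)})$; its elements are pairs $(\tau,\rho)$, $\tau\in S_m^r$, $\rho\in S_r$, with $(\tau_1,\rho_1)(\tau_2,\rho_2)=(\tau_1(\rho_1\cdot\tau_2),\rho_1\rho_2)$. The primitive action of $S_m\wr S_r$ on $\Omega^P(m,r,k)=\binom{[m]}{k}^r$ is $(\tau,\rho)(A_1,\dots,A_r)=(\tau_1(A_{\rho^{-1}(1)}),\dots,\tau_r(A_{\rho^{-1}(r)}))$. *)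

theory Defs
  imports
    Complex_Main
    "HOL-Computational_Algebra.Polynomial"
    "HOL-Algebra.Sym_Groups"
    "HOL-Algebra.Product_Groups"
    "HOL-Algebra.Group_Action"
    "HOL-Algebra.Generated_Fields"
    "HOL-Algebra.Algebraic_Closure_Type"
begin

section \<open>Polynomials of bounded height\<close>

definition height :: "int poly \<Rightarrow> int" where
  "height f = Max ((\<lambda>i. \<bar>poly.coeff f i\<bar>) ` {..Polynomial.degree f})"

definition monic_polys :: "nat \<Rightarrow> real \<Rightarrow> int poly set" where
  "monic_polys n H =
     {f. Polynomial.lead_coeff f = 1 \<and> Polynomial.degree f = n \<and> real_of_int (height f) \<le> H}"

text \<open>Separability is distinctness of the roots in an algebraic closure; \<^const>\<open>rsquarefree\<close>
  says that every root in the coefficient domain is simple, hence the passage to \<^typ>\<open>complex\<close>.\<close>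

definition separable :: "int poly \<Rightarrow> bool" where
  "separable f \<longleftrightarrow> rsquarefree (map_poly of_int f :: complex poly)"

definition root_set :: "int poly \<Rightarrow> complex set" where
  "root_set f = {\<alpha>. poly (map_poly of_int f) \<alpha> = 0}"

section \<open>Galois groups of subfields of the complex numbers\<close>

abbreviation complex_ring :: "complex ring" where
  "complex_ring \<equiv> ring_of_type_algebra"

definition adjoin :: "complex set \<Rightarrow> complex set \<Rightarrow> complex set" where
  "adjoin K S = generate_field complex_ring (K \<union> S)"

text \<open>Automorphisms are extensional functions (\<^term>\<open>undefined\<close> outside the field \<open>L\<close>), so that
  each of them is represented exactly once; the group operation is composition on \<open>L\<close>.\<close>

definition Gal :: "complex set \<Rightarrow> complex set \<Rightarrow> (complex \<Rightarrow> complex) monoid" where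
  "Gal L K = (BijGroup L)\<lparr>carrier :=
     {\<sigma> \<in> Bij L. \<sigma> \<in> ring_hom (complex_ring\<lparr>carrier := L\<rparr>) (complex_ring\<lparr>carrier := L\<rparr>)
              \<and> (\<forall>x\<in>K. \<sigma> x = x)}\<rparr>"

definition galois_group :: "int poly \<Rightarrow> (complex \<Rightarrow> complex) monoid" where
  "galois_group f = Gal (adjoin \<rat> (root_set f)) \<rat>"

definition galois_action :: "int poly \<Rightarrow> (complex \<Rightarrow> complex) \<Rightarrow> complex \<Rightarrow> complex" where
  "galois_action f \<sigma> = restrict \<sigma> (root_set f)"

section \<open>Permutation groups and their isomorphisms\<close>

text \<open>A permutation group is given by a group \<open>G\<close>, a set \<open>\<Omega>\<close> and an action \<open>\<phi>\<close>, as in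
  \<^locale>\<open>faithful_action\<close>.\<close>

definition perm_group_iso ::
  "('a, 'b) monoid_scheme \<Rightarrow> ('a \<Rightarrow> 'x \<Rightarrow> 'x) \<Rightarrow> 'x set \<Rightarrow>
   ('c, 'd) monoid_scheme \<Rightarrow> ('c \<Rightarrow> 'y \<Rightarrow> 'y) \<Rightarrow> 'y set \<Rightarrow> bool" where
  "perm_group_iso G1 \<phi>1 \<Omega>1 G2 \<phi>2 \<Omega>2 \<longleftrightarrow>
     (\<exists>h \<in> iso G1 G2. \<exists>b. bij_betw b \<Omega>1 \<Omega>2 \<and>
        (\<forall>\<sigma>\<in>carrier G1. \<forall>\<omega>\<in>\<Omega>1. \<phi>2 (h \<sigma>) (b \<omega>) = b (\<phi>1 \<sigma> \<omega>)))"

definition polys_with_group ::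
  "real \<Rightarrow> ('a, 'b) monoid_scheme \<Rightarrow> ('a \<Rightarrow> 'x \<Rightarrow> 'x) \<Rightarrow> 'x set \<Rightarrow> int poly set" where
  "polys_with_group H G \<phi> \<Omega> =
     {f \<in> monic_polys (card \<Omega>) H. separable f \<and>
        perm_group_iso (galois_group f) (galois_action f) (root_set f) G \<phi> \<Omega>}"

section \<open>The wreath product of symmetric groups and its primitive action\<close>

text \<open>The action of \<open>S\<^sub>r\<close> on \<open>r\<close>-tuples, with tuples as extensional functions on \<open>{1..r}\<close>.\<close>

definition permute_coords :: "nat \<Rightarrow> (nat \<Rightarrow> nat) \<Rightarrow> (nat \<Rightarrow> 'a) \<Rightarrow> nat \<Rightarrow> 'a" where
  "permute_coords r \<rho> x = (\<lambda>i\<in>{1..r}. x (inv' \<rho> i))"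

abbreviation sym_power :: "nat \<Rightarrow> nat \<Rightarrow> (nat \<Rightarrow> nat \<Rightarrow> nat) monoid" where
  "sym_power m r \<equiv> product_group {1..r} (\<lambda>_. sym_group m)"

definition sym_wreath :: "nat \<Rightarrow> nat \<Rightarrow> ((nat \<Rightarrow> nat \<Rightarrow> nat) \<times> (nat \<Rightarrow> nat)) monoid" where
  "sym_wreath m r =
     \<lparr>carrier = carrier (sym_power m r) \<times> carrier (sym_group r),
      monoid.mult = (\<lambda>(\<tau>1, \<rho>1) (\<tau>2, \<rho>2).
        (\<tau>1 \<otimes>\<^bsub>sym_power m r\<^esub> permute_coords r \<rho>1 \<tau>2, \<rho>1 \<otimes>\<^bsub>sym_group r\<^esub> \<rho>2)),
      one = (\<one>\<^bsub>sym_power m r\<^esub>, \<one>\<^bsub>sym_group r\<^esub>)\<rparr>"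

definition primitive_domain :: "nat \<Rightarrow> nat \<Rightarrow> nat \<Rightarrow> (nat \<Rightarrow> nat set) set" where
  "primitive_domain m r k = (\<Pi>\<^sub>E i\<in>{1..r}. {A. A \<subseteq> {1..m} \<and> card A = k})"

definition primitive_action ::
  "nat \<Rightarrow> nat \<Rightarrow> nat \<Rightarrow> (nat \<Rightarrow> nat \<Rightarrow> nat) \<times> (nat \<Rightarrow> nat) \<Rightarrow> (nat \<Rightarrow> nat set) \<Rightarrow> nat \<Rightarrow> nat set" where
  "primitive_action m r k = (\<lambda>(\<tau>, \<rho>). \<lambda>A\<in>primitive_domain m r k.
     \<lambda>i\<in>{1..r}. \<tau> i ` A (inv' \<rho> i))"

text \<open>As \<open>k\<close> is at least 1 and at most \<open>m / 2\<close>, the primitive action of the full wreath product is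
  faithful, see \<open>faithful_primitive_action\<close> below.\<close>

definition nonelemental_group ::
  "nat \<Rightarrow> nat \<Rightarrow> nat \<Rightarrow> ((nat \<Rightarrow> nat \<Rightarrow> nat) \<times> (nat \<Rightarrow> nat)) set \<Rightarrow> bool" where
  "nonelemental_group r m k G \<longleftrightarrow>
     subgroup G (sym_wreath m r) \<and>
     transitive_action ((sym_wreath m r)\<lparr>carrier := G\<rparr>) (primitive_domain m r k) (primitive_action m r k)"

section \<open>Well-definedness\<close>

lemma finite_monic_polys: "finite (monic_polys n H)"
proof -
  let ?B = "{-\<lfloor>H\<rfloor>..\<lfloor>H\<rfloor>}"
  have "monic_polys n H \<subseteq> Poly ` {xs. set xs \<subseteq> ?B \<and> length xs = Suc n}"
  proof
    fix f assume f: "f \<in> monic_polys n H"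
    have "\<bar>poly.coeff f i\<bar> \<le> \<lfloor>H\<rfloor>" if "i \<le> n" for i
    proof -
      have "\<bar>poly.coeff f i\<bar> \<le> height f"
        unfolding height_def using f that by (intro Max_ge) (auto simp: monic_polys_def)
      moreover have "height f \<le> \<lfloor>H\<rfloor>" using f by (auto simp: monic_polys_def le_floor_iff)
      ultimately show ?thesis by linarith
    qed
    hence "set (map (poly.coeff f) [0..<Suc n]) \<subseteq> ?B" by (auto simp: abs_le_iff less_Suc_eq_le minus_le_iff simp del: upt_Suc)
    moreover have "f = Poly (map (poly.coeff f) [0..<Suc n])"
      using f by (intro poly_eqI) (auto simp: monic_polys_def nth_default_def coeff_eq_0
          simp del: upt_Suc)
    ultimately show "f \<in> Poly ` {xs. set xs \<subseteq> ?B \<and> length xs = Suc n}"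
      by (intro image_eqI[where x = "map (poly.coeff f) [0..<Suc n]"]) auto
  qed
  thus ?thesis by (rule finite_subset) (intro finite_imageI finite_lists_length_eq; simp)
qed

lemma finite_polys_with_group: "finite (polys_with_group H G \<phi> \<Omega>)"
  by (rule finite_subset[OF _ finite_monic_polys]) (auto simp: polys_with_group_def)

lemma sym_wreath_carrier:
  "(\<tau>, \<rho>) \<in> carrier (sym_wreath m r) \<longleftrightarrow>
     \<tau> \<in> extensional {1..r} \<and> (\<forall>i\<in>{1..r}. \<tau> i permutes {1..m}) \<and> \<rho> permutes {1..r}"
  by (auto simp: sym_wreath_def sym_group_carrier PiE_iff)

lemma sym_wreath_mult:
  "(\<tau>1, \<rho>1) \<otimes>\<^bsub>sym_wreath m r\<^esub> (\<tau>2, \<rho>2) =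
     ((\<lambda>i\<in>{1..r}. \<tau>1 i \<circ> \<tau>2 (inv' \<rho>1 i)), \<rho>1 \<circ> \<rho>2)"
  by (auto simp: sym_wreath_def sym_group_mult permute_coords_def fun_eq_iff)

lemma inv_permutes_mem: "\<rho> permutes S \<Longrightarrow> i \<in> S \<Longrightarrow> inv' \<rho> i \<in> S"
  by (meson permutes_in_image permutes_inv)

lemma group_sym_wreath: "group (sym_wreath m r)"
proof (rule groupI)
  fix x y assume "x \<in> carrier (sym_wreath m r)" "y \<in> carrier (sym_wreath m r)"
  thus "x \<otimes>\<^bsub>sym_wreath m r\<^esub> y \<in> carrier (sym_wreath m r)"
    using inv_permutes_mem[of "snd x" "{1..r}"]
    by (cases x; cases y) (auto simp: sym_wreath_carrier sym_wreath_mult permutes_compose simp del: atLeastAtMost_iff)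
next
  show "\<one>\<^bsub>sym_wreath m r\<^esub> \<in> carrier (sym_wreath m r)"
    by (auto simp: sym_wreath_def sym_group_def permutes_id)
next
  fix x y z assume *: "x \<in> carrier (sym_wreath m r)" "y \<in> carrier (sym_wreath m r)"
    "z \<in> carrier (sym_wreath m r)"
  obtain t1 r1 t2 r2 t3 r3 where [simp]: "x = (t1, r1)" "y = (t2, r2)" "z = (t3, r3)"
    by (cases x; cases y; cases z) auto
  have r: "r1 permutes {1..r}" "r2 permutes {1..r}" using * by (auto simp: sym_wreath_carrier)
  have "inv' (r1 \<circ> r2) = inv' r2 \<circ> inv' r1" using r by (meson o_inv_distrib permutes_bij)
  thus "x \<otimes>\<^bsub>sym_wreath m r\<^esub> y \<otimes>\<^bsub>sym_wreath m r\<^esub> z =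
        x \<otimes>\<^bsub>sym_wreath m r\<^esub> (y \<otimes>\<^bsub>sym_wreath m r\<^esub> z)"
    using inv_permutes_mem[OF r(1)]
    by (auto simp: sym_wreath_mult fun_eq_iff simp del: atLeastAtMost_iff)
next
  fix x assume "x \<in> carrier (sym_wreath m r)"
  then obtain t p where [simp]: "x = (t, p)" and t: "t \<in> extensional {1..r}"
    "\<And>i. i \<in> {1..r} \<Longrightarrow> t i permutes {1..m}" and p: "p permutes {1..r}"
    by (cases x) (auto simp: sym_wreath_carrier simp del: atLeastAtMost_iff)
  show "\<one>\<^bsub>sym_wreath m r\<^esub> \<otimes>\<^bsub>sym_wreath m r\<^esub> x = x"
    using t(1) by (auto simp: sym_wreath_def sym_group_def permute_coords_def fun_eq_iff extensional_def)
  let ?y = "((\<lambda>i\<in>{1..r}. inv' (t (p i))), inv' p)"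
  have pp: "p i \<in> {1..r}" if "i \<in> {1..r}" for i using that p by (metis permutes_in_image)
  have "?y \<in> carrier (sym_wreath m r)"
    using t(2) pp p by (auto simp: sym_wreath_carrier permutes_inv simp del: atLeastAtMost_iff)
  moreover have "?y \<otimes>\<^bsub>sym_wreath m r\<^esub> x = \<one>\<^bsub>sym_wreath m r\<^esub>"
    using permutes_inverses(2)[OF t(2)[OF pp]] p unfolding \<open>x = (t, p)\<close> sym_wreath_mult
    by (auto simp: permutes_inv_inv sym_wreath_def sym_group_def fun_eq_iff permutes_inverses
        simp del: atLeastAtMost_iff)
  ultimately show "\<exists>y\<in>carrier (sym_wreath m r). y \<otimes>\<^bsub>sym_wreath m r\<^esub> x = \<one>\<^bsub>sym_wreath m r\<^esub>"
    by blast
qed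

lemma primitive_action_closed:
  assumes "(\<tau>, \<rho>) \<in> carrier (sym_wreath m r)" "A \<in> primitive_domain m r k"
  shows "primitive_action m r k (\<tau>, \<rho>) A \<in> primitive_domain m r k"
proof -
  have "\<tau> i ` B \<subseteq> {1..m} \<and> card (\<tau> i ` B) = k"
    if "i \<in> {1..r}" "B \<subseteq> {1..m}" "card B = k" for i B
  proof -
    have p: "\<tau> i permutes {1..m}" using assms(1) that(1) by (auto simp: sym_wreath_carrier)
    thus ?thesis using that(2,3) permutes_image[OF p] permutes_inj[OF p]
      by (metis card_image image_mono inj_on_subset subset_UNIV)
  qed
  moreover have "inv' \<rho> i \<in> {1..r}" if "i \<in> {1..r}" for i
    using assms(1) that inv_permutes_mem[of \<rho> "{1..r}" i] by (auto simp: sym_wreath_carrier)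
  ultimately show ?thesis using assms(2)
    unfolding primitive_action_def by (simp add: primitive_domain_def PiE_iff del: atLeastAtMost_iff)
qed

lemma primitive_action_mult:
  assumes "g \<in> carrier (sym_wreath m r)" "h \<in> carrier (sym_wreath m r)" "A \<in> primitive_domain m r k"
  shows "primitive_action m r k (g \<otimes>\<^bsub>sym_wreath m r\<^esub> h) A =
         primitive_action m r k g (primitive_action m r k h A)"
proof -
  obtain t1 r1 t2 r2 where [simp]: "g = (t1, r1)" "h = (t2, r2)" by (cases g; cases h) auto
  have r: "r1 permutes {1..r}" "r2 permutes {1..r}" using assms by (auto simp: sym_wreath_carrier)
  have "inv' (r1 \<circ> r2) = inv' r2 \<circ> inv' r1" using r by (meson o_inv_distrib permutes_bij)
  moreover have "primitive_action m r k (t2, r2) A \<in> primitive_domain m r k"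
    using assms primitive_action_closed by auto
  moreover have "primitive_action m r k (t2, r2) A = (\<lambda>i\<in>{1..r}. t2 i ` A (inv' r2 i))"
    using assms by (simp add: primitive_action_def)
  ultimately show ?thesis
    using assms(3) inv_permutes_mem[OF r(1)]
    by (auto simp: sym_wreath_mult primitive_action_def fun_eq_iff image_comp
        simp del: atLeastAtMost_iff)
qed

lemma primitive_action_one:
  assumes "A \<in> primitive_domain m r k"
  shows "primitive_action m r k \<one>\<^bsub>sym_wreath m r\<^esub> A = A"
  using assms by (auto simp: primitive_action_def sym_wreath_def sym_group_def primitive_domain_def
      fun_eq_iff PiE_iff extensional_def)

lemma group_action_primitive:
  "group_action (sym_wreath m r) (primitive_domain m r k) (primitive_action m r k)"
proof -
  interpret W: group "sym_wreath m r" by (rule group_sym_wreath)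
  let ?a = "primitive_action m r k" and ?D = "primitive_domain m r k"
  have cl: "?a g A \<in> ?D" if "g \<in> carrier (sym_wreath m r)" "A \<in> ?D" for g A
    using that primitive_action_closed by (cases g) auto
  have ext: "?a g \<in> extensional ?D" for g
    by (cases g) (auto simp: primitive_action_def)
  have bij: "?a g \<in> Bij ?D" if g: "g \<in> carrier (sym_wreath m r)" for g
  proof -
    have "bij_betw (?a g) ?D ?D"
      by (rule bij_betw_byWitness[where f' = "?a (inv\<^bsub>sym_wreath m r\<^esub> g)"])
        (use g in \<open>auto simp: cl simp flip: primitive_action_mult simp: primitive_action_one\<close>)
    thus ?thesis using ext by (auto simp: Bij_def)
  qed
  have "?a \<in> hom (sym_wreath m r) (BijGroup ?D)"
  proof (rule homI)
    fix x y assume "x \<in> carrier (sym_wreath m r)" "y \<in> carrier (sym_wreath m r)"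
    thus "?a (x \<otimes>\<^bsub>sym_wreath m r\<^esub> y) = ?a x \<otimes>\<^bsub>BijGroup ?D\<^esub> ?a y"
      by (intro extensionalityI[where A = ?D] ext)
        (auto simp: BijGroup_def bij primitive_action_mult compose_def)
  qed (auto simp: BijGroup_def bij)
  thus ?thesis
    by (intro group_action.intro group_hom.intro group_hom_axioms.intro group_BijGroup W.group_axioms)
qed

lemma faithful_primitive_action:
  assumes "1 \<le> k" "real k \<le> real m / 2"
  shows "faithful_action (sym_wreath m r) (primitive_domain m r k) (primitive_action m r k)"
proof -
  have km: "1 \<le> k" "k < m" using assms by linarith+
  interpret group_action "sym_wreath m r" "primitive_domain m r k" "primitive_action m r k"
    by (rule group_action_primitive)
  interpret h: group_hom "sym_wreath m r" "BijGroup (primitive_domain m r k)" "primitive_action m r k"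
    by (rule group_hom)
  have sep: "\<exists>B. B \<subseteq> {1..m} \<and> card B = k \<and> a \<in> B \<and> b \<notin> B"
    if "a \<in> {1..m}" "b \<in> {1..m}" "a \<noteq> b" for a b
  proof -
    have "k - 1 \<le> card ({1..m} - {a, b})" using that km by (subst card_Diff_subset) auto
    then obtain B where B: "B \<subseteq> {1..m} - {a, b}" "card B = k - 1" "finite B"
      by (rule obtain_subset_with_card_n)
    thus ?thesis using that km by (intro exI[of _ "insert a B"]) (auto simp: card_insert_if)
  qed
  have "g = \<one>\<^bsub>sym_wreath m r\<^esub>"
    if g: "g \<in> carrier (sym_wreath m r)"
      and triv: "primitive_action m r k g = \<one>\<^bsub>BijGroup (primitive_domain m r k)\<^esub>" for g
  proof -
    obtain t p where [simp]: "g = (t, p)" by (cases g)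
    have t: "t \<in> extensional {1..r}" "\<And>i. i \<in> {1..r} \<Longrightarrow> t i permutes {1..m}"
      and p: "p permutes {1..r}" using g by (auto simp: sym_wreath_carrier simp del: atLeastAtMost_iff)
    have fixA: "t i ` A (inv' p i) = A i" if "A \<in> primitive_domain m r k" "i \<in> {1..r}" for A i
    proof -
      have "primitive_action m r k g A = A" using triv that by (simp add: BijGroup_def)
      from fun_cong[OF this, of i] that show ?thesis by (simp add: primitive_action_def)
    qed
    obtain B where B: "B \<subseteq> {1..m}" "card B = k" "1 \<in> B" "2 \<notin> B"
      using sep[of 1 2] km by auto
    obtain B' where B': "B' \<subseteq> {1..m}" "card B' = k" "2 \<in> B'" "1 \<notin> B'"
      using sep[of 2 1] km by auto
    have p_id: "inv' p i = i" if i: "i \<in> {1..r}" for i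
    proof (rule ccontr)
      assume ne: "inv' p i \<noteq> i"
      have j: "inv' p i \<in> {1..r}" using inv_permutes_mem[OF p i] .
      let ?A = "\<lambda>C. \<lambda>l\<in>{1..r}. if l = i then C else B"
      have "?A B \<in> primitive_domain m r k" "?A B' \<in> primitive_domain m r k"
        using B B' by (auto simp: primitive_domain_def)
      from fixA[OF this(1) i] fixA[OF this(2) i] i j ne have "B = B'" by simp
      thus False using B B' by auto
    qed
    have "p i = i" for i
    proof (cases "i \<in> {1..r}")
      case True
      thus ?thesis using p_id p by (metis permutes_inverses(1))
    next
      case False
      thus ?thesis using p by (simp add: permutes_not_in)
    qed
    hence "p = id" by auto
    moreover have "t i a = a" if i: "i \<in> {1..r}" for i a
    proof (rule ccontr)
      assume ne: "t i a \<noteq> a"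
      have a: "a \<in> {1..m}" using ne t(2)[OF i] by (meson permutes_not_in)
      have b: "t i a \<in> {1..m}" using a t(2)[OF i] by (metis permutes_in_image)
      obtain C where C: "C \<subseteq> {1..m}" "card C = k" "a \<in> C" "t i a \<notin> C"
        using sep[OF a b] ne by auto
      have "(\<lambda>l\<in>{1..r}. C) \<in> primitive_domain m r k" using C by (auto simp: primitive_domain_def)
      from fixA[OF this i] have "t i ` C = C" using i p_id[OF i] by simp
      thus False using C by auto
    qed
    hence "t = (\<lambda>i\<in>{1..r}. id)" using t(1) by (auto simp: fun_eq_iff extensional_def)
    ultimately show ?thesis by (simp add: sym_wreath_def sym_group_def)
  qed
  hence "inj_on (primitive_action m r k) (carrier (sym_wreath m r))"
    by (auto simp: h.inj_iff_trivial_ker kernel_def)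
  thus ?thesis by unfold_locales
qed

end

theory Submission
  imports Defs "HOL-Analysis.Summation_Tests" "Jordan_Normal_Form.Char_Poly"
    "Berlekamp_Zassenhaus.Mahler_Measure"
begin

text \<open>
  Write \<open>N\<close> for \<open>m choose k\<close> and \<open>n = N ^ r\<close>. A polynomial \<open>f\<close> in question has \<open>n\<close> roots
  \<open>\<alpha> A\<close>, labelled by tuples \<open>A = (A 1, \<dots>, A r)\<close> of \<open>k\<close>-subsets of \<open>{1..m}\<close>, and every automorphism of
  its splitting field permutes the labels through an element of the wreath product. The labelling is
  used to replace the \<open>n\<close> integer coefficients of \<open>f\<close> by a much shorter list of integers that still
  determines \<open>f\<close> up to boundedly many choices.

  Put \<open>\<beta> i a = (\<Prod>A | A i = a. t - \<alpha> A)\<close>, with an integer \<open>t\<close> for which these \<open>r * N\<close> numbers are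
  distinct, and \<open>g i (X) = (\<Prod>a. X - \<beta> i a)\<close>; below, \<open>\<beta> i a\<close> is \<open>fibre_value t i a\<close> and
  \<open>g i (u + w)\<close> is \<open>block_value t u w i\<close>. Automorphisms permute the \<open>g i\<close>. The point is the
  size of the \<open>g i\<close>: up to a constant, every value \<open>g i (x)\<close> at a bounded integer \<open>x\<close> is at most the
  Mahler measure of \<open>f\<close>, because each root of \<open>f\<close> enters \<open>g i\<close> exactly once; and the Mahler measure
  is \<open>\<lesssim> H\<close> by Landau's inequality. A bounded \<open>u\<close> makes the \<open>r\<close> values \<open>\<gamma> i = g i (u)\<close> distinct.
  The code of \<open>f\<close> is assembled as follows.

  \<^item> The polynomial \<open>\<Prod>i. X - \<gamma> i\<close> has rational integer values, and its values at \<open>0, \<dots>, r - 1\<close> are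
    \<open>\<lesssim> H ^ r\<close>, so there are \<open>\<lesssim> H ^ (r * r)\<close> of these polynomials; each determines the
    \<open>\<gamma> i\<close> up to order.
  \<^item> Given the \<open>\<gamma> i\<close>, the action of automorphisms on the indices \<open>i\<close> is known. A family of algebraic
    integers that is permuted by automorphisms in a known way is determined by its approximations
    within a fixed error (lemma \<open>eq_if_buckets_eq\<close>): the product of the nonzero differences of two such
    families is a nonzero rational integer, and it cannot have factors that are all less
    than \<open>1\<close>. Hence the \<open>r * (N - 1)\<close> numbers \<open>g i (u + w)\<close>, \<open>1 \<le> w < N\<close>, all \<open>\<lesssim> H\<close>, allow
    \<open>\<lesssim> H ^ (r * (N - 1))\<close> choices. By interpolation they determine each \<open>g i\<close>, hence the \<open>\<beta> i a\<close> up
    to order.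
  \<^item> As the \<open>\<beta> i a\<close> are distinct, they reveal how automorphisms act on the labels \<open>A\<close>. So the same
    principle applies to the \<open>\<alpha> A\<close>: approximations within a fixed error suffice, and as the product
    of the \<open>max 1 \<bar>\<alpha> A\<bar>\<close> is \<open>\<lesssim> H\<close>, there are only \<open>\<lesssim> H powr (1 + \<epsilon>)\<close> of them
    (lemma \<open>card_bounded_height_product\<close>).

  The total is \<open>H powr (r * r + r * (N - 1) + 1 + \<epsilon>)\<close>, which is the asserted bound.

  Two facts from algebraic number theory enter. Sums and products of algebraic integers are algebraic
  integers. And an algebraic number fixed by all automorphisms is rational; it is obtained for
  field homomorphisms into \<open>\<complex>\<close> defined on a field that contains all algebraic numbers, so that
  different polynomials can be compared without forming composite splitting fields. Such a
  homomorphism restricts to an element of the Galois group of every polynomial.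
\<close>

section \<open>Algebraic integers form a ring\<close>

definition int_span :: "complex set \<Rightarrow> complex set" where
  "int_span S = range (\<lambda>c :: complex \<Rightarrow> int. \<Sum>s\<in>S. of_int (c s) * s)"

lemma int_span_incl: "finite S \<Longrightarrow> s \<in> S \<Longrightarrow> s \<in> int_span S"
  unfolding int_span_def
  by (rule range_eqI[of _ _ "\<lambda>t. if t = s then 1 else 0"]) (simp add: if_distrib if_distribR sum.delta cong: if_cong)

lemma int_span_add: "x \<in> int_span S \<Longrightarrow> y \<in> int_span S \<Longrightarrow> x + y \<in> int_span S"
  unfolding int_span_def
proof safe
  fix c d :: "complex \<Rightarrow> int"
  show "(\<Sum>s\<in>S. of_int (c s) * s) + (\<Sum>s\<in>S. of_int (d s) * s) \<in> range (\<lambda>c. \<Sum>s\<in>S. of_int (c s) * s)"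
    by (rule range_eqI[of _ _ "\<lambda>s. c s + d s"]) (simp add: sum.distrib algebra_simps)
qed

lemma int_span_scale: "x \<in> int_span S \<Longrightarrow> of_int a * x \<in> int_span S"
  unfolding int_span_def
proof safe
  fix c :: "complex \<Rightarrow> int"
  show "of_int a * (\<Sum>s\<in>S. of_int (c s) * s) \<in> range (\<lambda>c. \<Sum>s\<in>S. of_int (c s) * s)"
    by (rule range_eqI[of _ _ "\<lambda>s. a * c s"]) (simp add: sum_distrib_left mult.assoc)
qed

lemma int_span_sum:
  assumes "\<And>i. i \<in> I \<Longrightarrow> f i \<in> int_span S"
  shows "(\<Sum>i\<in>I. f i) \<in> int_span S"
  using assms
proof (induction I rule: infinite_finite_induct)
  case (insert i I) thus ?case by (simp add: int_span_add)
qed (auto simp: int_span_def intro!: range_eqI[of _ _ "\<lambda>_. 0"])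

lemma int_span_mult_closed:
  assumes "\<And>s. s \<in> S \<Longrightarrow> x * s \<in> int_span S" "y \<in> int_span S"
  shows "x * y \<in> int_span S"
proof -
  obtain c where y: "y = (\<Sum>s\<in>S. of_int (c s) * s)" using assms(2) by (auto simp: int_span_def)
  have "x * y = (\<Sum>s\<in>S. of_int (c s) * (x * s))"
    by (simp add: y sum_distrib_left mult_ac)
  thus ?thesis using assms(1) by (simp add: int_span_sum int_span_scale)
qed

text \<open>Multiplication by \<open>x\<close> acts on the generators by an integer matrix, of which \<open>x\<close> is an
  eigenvalue; the characteristic polynomial of that matrix is monic with integer coefficients.\<close>
lemma algebraic_int_if_int_span_stable:
  assumes "finite S" "\<exists>s\<in>S. s \<noteq> 0" and stable: "\<And>s. s \<in> S \<Longrightarrow> x * s \<in> int_span S"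
  shows "algebraic_int x"
proof -
  define n where "n = card S"
  obtain e where e: "bij_betw e {0..<n} S" unfolding n_def using ex_bij_betw_nat_finite[OF assms(1)] by blast
  have "\<exists>c :: complex \<Rightarrow> int. x * s = (\<Sum>t\<in>S. of_int (c t) * t)" if "s \<in> S" for s
    using stable[OF that] by (auto simp: int_span_def)
  then obtain c :: "complex \<Rightarrow> complex \<Rightarrow> int"
    where c: "\<And>s. s \<in> S \<Longrightarrow> x * s = (\<Sum>t\<in>S. of_int (c s t) * t)" by metis
  define A where "A = mat n n (\<lambda>(i, j). c (e i) (e j))"
  define A' where "A' = map_mat (of_int :: int \<Rightarrow> complex) A"
  define v where "v = vec n e"
  have A: "A \<in> carrier_mat n n" "A' \<in> carrier_mat n n" by (auto simp: A_def A'_def)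
  have "A' *\<^sub>v v = x \<cdot>\<^sub>v v"
  proof (rule eq_vecI)
    fix i assume i: "i < dim_vec (x \<cdot>\<^sub>v v)"
    hence i: "i < n" by (simp add: v_def)
    hence "e i \<in> S" using e by (auto simp: bij_betw_def)
    have "(A' *\<^sub>v v) $ i = (\<Sum>j\<in>{0..<n}. of_int (c (e i) (e j)) * e j)"
      using i by (simp add: A_def A'_def v_def scalar_prod_def)
    also have "\<dots> = (\<Sum>t\<in>S. of_int (c (e i) t) * t)"
      by (rule sum.reindex_bij_betw[OF e])
    also have "\<dots> = x * e i" using c[OF \<open>e i \<in> S\<close>] by simp
    finally show "(A' *\<^sub>v v) $ i = (x \<cdot>\<^sub>v v) $ i" using i by (simp add: v_def)
  qed (auto simp: A'_def A_def v_def)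
  moreover have "v \<noteq> 0\<^sub>v n"
  proof
    assume v0: "v = 0\<^sub>v n"
    obtain s where s: "s \<in> S" "s \<noteq> 0" using assms(2) by blast
    then obtain i where "i < n" "e i = s" using e by (auto simp: bij_betw_def)
    thus False using s v0 by (metis index_vec index_zero_vec(1) v_def)
  qed
  ultimately have "eigenvalue A' x"
    unfolding eigenvalue_def eigenvector_def using A by (intro exI[of _ v]) (auto simp: v_def)
  hence "poly (char_poly A') x = 0" using eigenvalue_root_char_poly A by blast
  moreover have "char_poly A' = map_poly of_int (char_poly A)"
    unfolding A'_def by (rule of_int_hom.char_poly_hom[OF A(1)])
  moreover have "lead_coeff (char_poly A) = 1" using degree_monic_char_poly[OF A(1)] by simp
  ultimately show ?thesis by (auto simp: algebraic_int_altdef_ipoly)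
qed

lemma root_power_eq_sum:
  assumes "poly (map_poly of_int p) x = 0" "lead_coeff p = 1"
  shows "(x :: complex) ^ Polynomial.degree p
    = (\<Sum>i<Polynomial.degree p. of_int (- poly.coeff p i) * x ^ i)"
proof -
  have "0 = (\<Sum>i\<le>Polynomial.degree p. of_int (poly.coeff p i) * x ^ i)"
    using assms(1) by (simp add: poly_altdef degree_map_poly coeff_map_poly)
  also have "\<dots> = x ^ Polynomial.degree p + (\<Sum>i<Polynomial.degree p. of_int (poly.coeff p i) * x ^ i)"
    using assms(2) by (simp flip: lessThan_Suc_atMost)
  finally show ?thesis by (simp add: sum_negf eq_neg_iff_add_eq_0)
qed

text \<open>The products of small powers of two algebraic integers generate a lattice that is stable under
  multiplication by either of them: only the top power of \<open>x\<close> leaves the list of generators, and the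
  equation of \<open>x\<close> reduces it. Exchanging \<open>x\<close> and \<open>y\<close> exchanges the roles of \<open>p\<close> and \<open>d\<close>.\<close>
lemma int_span_power_products_stable:
  fixes x y :: complex
  defines "S \<equiv> \<lambda>p d. (\<lambda>(i, j). x ^ i * y ^ j) ` ({..<Polynomial.degree p} \<times> {..<d :: nat})"
  assumes p: "poly (map_poly of_int p) x = 0" "lead_coeff p = 1" and s: "s \<in> S p d"
  shows "x * s \<in> int_span (S p d)"
proof -
  have fin: "finite (S p d)" by (simp add: S_def)
  obtain i j where s: "s = x ^ i * y ^ j" "i < Polynomial.degree p" "j < d"
    using s by (auto simp: S_def)
  show ?thesis
  proof (cases "Suc i < Polynomial.degree p")
    case True
    hence "x * s \<in> S p d" using s by (auto simp: S_def intro!: image_eqI[of _ _ "(Suc i, j)"])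
    thus ?thesis using int_span_incl fin by blast
  next
    case False
    hence "Suc i = Polynomial.degree p" using s by simp
    hence "x * s = x ^ Polynomial.degree p * y ^ j" using s by (simp flip: \<open>Suc i = _\<close>)
    also have "\<dots> = (\<Sum>l<Polynomial.degree p. of_int (- poly.coeff p l) * (x ^ l * y ^ j))"
      by (subst root_power_eq_sum[OF p]) (simp add: sum_distrib_right mult.assoc)
    also have "\<dots> \<in> int_span (S p d)"
      using s by (intro int_span_sum int_span_scale int_span_incl fin)
        (auto simp: S_def intro!: image_eqI[of _ _ "(_, j)"])
    finally show ?thesis .
  qed
qed

lemma algebraic_int_add_mult:
  assumes "algebraic_int x" "algebraic_int y"
  shows "algebraic_int (x + y)" "algebraic_int (x * y :: complex)"
proof -
  obtain p where p: "poly (map_poly of_int p) x = 0" "lead_coeff p = 1"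
    using assms(1) by (auto simp: algebraic_int_altdef_ipoly)
  obtain q where q: "poly (map_poly of_int q) y = 0" "lead_coeff q = 1"
    using assms(2) by (auto simp: algebraic_int_altdef_ipoly)
  have pos: "Polynomial.degree g > 0"
    if "poly (map_poly of_int g) z = 0" "lead_coeff g = 1" for g and z :: complex
    using that by (intro Nat.gr0I) (simp add: poly_altdef degree_map_poly coeff_map_poly)
  define S where "S = (\<lambda>(i, j). x ^ i * y ^ j) ` ({..<Polynomial.degree p} \<times> {..<Polynomial.degree q})"
  have S': "S = (\<lambda>(i, j). y ^ i * x ^ j) ` ({..<Polynomial.degree q} \<times> {..<Polynomial.degree p})"
    unfolding S_def by (subst product_swap[symmetric]) (simp add: image_image case_prod_unfold mult.commute)
  have fin: "finite S" by (simp add: S_def)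
  have one: "\<exists>s\<in>S. s \<noteq> 0" using pos[OF p] pos[OF q]
    by (auto simp: S_def intro!: bexI[of _ "(0, 0)"])
  have xs: "x * s \<in> int_span S" if "s \<in> S" for s
    using int_span_power_products_stable[OF p] that unfolding S_def by blast
  have ys: "y * s \<in> int_span S" if "s \<in> S" for s
    using int_span_power_products_stable[OF q] that unfolding S' by blast
  show "algebraic_int (x + y)"
    using fin one xs ys by (intro algebraic_int_if_int_span_stable[of S]) (auto simp: distrib_right int_span_add)
  have "(x * y) * s \<in> int_span S" if "s \<in> S" for s
    using int_span_mult_closed[OF xs ys[OF that]] by (simp add: mult.assoc)
  thus "algebraic_int (x * y)"
    using fin one by (intro algebraic_int_if_int_span_stable[of S])
qed

lemma algebraic_int_diff: "algebraic_int x \<Longrightarrow> algebraic_int y \<Longrightarrow> algebraic_int (x - y :: complex)"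
  using algebraic_int_add_mult(1)[of x "- y"] by simp

lemma algebraic_int_prod:
  "(\<And>i. i \<in> I \<Longrightarrow> algebraic_int (f i)) \<Longrightarrow> algebraic_int (\<Prod>i\<in>I. f i :: complex)"
  by (induction I rule: infinite_finite_induct) (auto intro: algebraic_int_add_mult)

section \<open>Embeddings of the algebraic numbers\<close>

text \<open>Homomorphisms between subrings of \<open>\<complex>\<close> are handled as their graphs, which are
  subrings of \<open>\<complex> \<times> \<complex>\<close>. In this form extensions are inclusions, ready for Zorn's lemma, and
  injectivity and single-valuedness become one condition on zero that is symmetric in both
  coordinates.\<close>
definition hom_graph :: "(complex \<times> complex) set \<Rightarrow> bool" where
  "hom_graph G \<longleftrightarrow> (1, 1) \<in> G \<and>
     (\<forall>x y x' y'. (x, y) \<in> G \<longrightarrow> (x', y') \<in> G \<longrightarrow> (x + x', y + y') \<in> G \<and> (x * x', y * y') \<in> G) \<and>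
     (\<forall>x y. (x, y) \<in> G \<longrightarrow> (- x, - y) \<in> G \<and> (x = 0 \<longleftrightarrow> y = 0))"

definition inverse_closed :: "(complex \<times> complex) set \<Rightarrow> bool" where
  "inverse_closed G \<longleftrightarrow> (\<forall>x y. (x, y) \<in> G \<longrightarrow> (inverse x, inverse y) \<in> G)"

text \<open>The pairs consist of a polynomial over the domain and its image under the homomorphism.\<close>
definition graph_polys :: "(complex \<times> complex) set \<Rightarrow> (complex poly \<times> complex poly) set" where
  "graph_polys G = {(A, B). \<forall>i. (poly.coeff A i, poly.coeff B i) \<in> G}"

text \<open>The first component is the minimal polynomial of \<open>s\<close> over the domain of \<open>G\<close>, the second one its
  image.\<close>
definition minimal_root_pair ::
  "(complex \<times> complex) set \<Rightarrow> complex \<Rightarrow> complex poly \<Rightarrow> complex poly \<Rightarrow> bool" where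
  "minimal_root_pair G s P Q \<longleftrightarrow> (P, Q) \<in> graph_polys G \<and> lead_coeff P = 1 \<and> poly P s = 0 \<and>
     (\<forall>A B. (A, B) \<in> graph_polys G \<longrightarrow> A \<noteq> 0 \<longrightarrow> poly A s = 0 \<longrightarrow>
        Polynomial.degree P \<le> Polynomial.degree A)"

context
  fixes G assumes G: "hom_graph G"
begin

lemma hom_graph_one: "(1, 1) \<in> G"
  and hom_graph_add: "(x, y) \<in> G \<Longrightarrow> (x', y') \<in> G \<Longrightarrow> (x + x', y + y') \<in> G"
  and hom_graph_mult: "(x, y) \<in> G \<Longrightarrow> (x', y') \<in> G \<Longrightarrow> (x * x', y * y') \<in> G"
  and hom_graph_minus: "(x, y) \<in> G \<Longrightarrow> (- x, - y) \<in> G"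
  and hom_graph_zero_iff: "(x, y) \<in> G \<Longrightarrow> x = 0 \<longleftrightarrow> y = 0"
  using G unfolding hom_graph_def by blast+

lemma hom_graph_diff: "(x, y) \<in> G \<Longrightarrow> (x', y') \<in> G \<Longrightarrow> (x - x', y - y') \<in> G"
  using hom_graph_add[OF _ hom_graph_minus] by simp

lemma hom_graph_zero: "(0, 0) \<in> G"
  using hom_graph_diff[OF hom_graph_one hom_graph_one] by simp

lemma hom_graph_sum:
  "(\<And>i. i \<in> I \<Longrightarrow> (f i, g i) \<in> G) \<Longrightarrow> ((\<Sum>i\<in>I. f i), (\<Sum>i\<in>I. g i)) \<in> G"
  by (induction I rule: infinite_finite_induct) (auto intro: hom_graph_add hom_graph_zero)

lemma hom_graph_single_valued: "(x, y) \<in> G \<Longrightarrow> (x, y') \<in> G \<Longrightarrow> y = y'"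
  using hom_graph_zero_iff[OF hom_graph_diff] by fastforce

lemma hom_graph_of_nat: "(of_nat n, of_nat n) \<in> G"
  by (induction n) (auto intro: hom_graph_add hom_graph_zero hom_graph_one)

lemma hom_graph_of_int: "(of_int n, of_int n) \<in> G"
  by (cases n) (auto simp: hom_graph_of_nat simp del: of_nat_Suc intro: hom_graph_minus)

lemma hom_graph_converse: "hom_graph (G\<inverse>)"
  using G unfolding hom_graph_def by auto

lemma graph_polys_const: "(x, y) \<in> G \<Longrightarrow> ([:x:], [:y:]) \<in> graph_polys G"
  by (auto simp: graph_polys_def coeff_pCons hom_graph_zero split: nat.splits)

lemma graph_polys_monom: "(x, y) \<in> G \<Longrightarrow> (Polynomial.monom x n, Polynomial.monom y n) \<in> graph_polys G"
  by (auto simp: graph_polys_def hom_graph_zero)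

lemma graph_polys_add:
  "(A, B) \<in> graph_polys G \<Longrightarrow> (A', B') \<in> graph_polys G \<Longrightarrow> (A + A', B + B') \<in> graph_polys G"
  by (auto simp: graph_polys_def hom_graph_add)

lemma graph_polys_minus: "(A, B) \<in> graph_polys G \<Longrightarrow> (- A, - B) \<in> graph_polys G"
  by (auto simp: graph_polys_def hom_graph_minus)

lemma graph_polys_diff:
  "(A, B) \<in> graph_polys G \<Longrightarrow> (A', B') \<in> graph_polys G \<Longrightarrow> (A - A', B - B') \<in> graph_polys G"
  by (auto simp: graph_polys_def hom_graph_diff)

lemma graph_polys_mult:
  "(A, B) \<in> graph_polys G \<Longrightarrow> (A', B') \<in> graph_polys G \<Longrightarrow> (A * A', B * B') \<in> graph_polys G"
  by (auto simp: graph_polys_def coeff_mult intro!: hom_graph_sum hom_graph_mult)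

lemma graph_polys_zero: "(0, 0) \<in> graph_polys G"
  by (auto simp: graph_polys_def hom_graph_zero)

lemma graph_polys_zero_iff: "(A, B) \<in> graph_polys G \<Longrightarrow> A = 0 \<longleftrightarrow> B = 0"
  using hom_graph_zero_iff by (fastforce simp: graph_polys_def poly_eq_iff)

lemma graph_polys_degree: "(A, B) \<in> graph_polys G \<Longrightarrow> Polynomial.degree A = Polynomial.degree B"
  unfolding Polynomial.degree_def graph_polys_def
  using hom_graph_zero_iff by (intro arg_cong[of _ _ Least]) (fastforce simp: fun_eq_iff)

lemma graph_polys_lead_coeff:
  assumes "(A, B) \<in> graph_polys G" "lead_coeff A = 1"
  shows "lead_coeff B = 1"
proof -
  have "(lead_coeff A, lead_coeff B) \<in> G"
    using assms(1) graph_polys_degree[OF assms(1)] by (auto simp: graph_polys_def)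
  thus ?thesis using assms(2) hom_graph_single_valued[OF _ hom_graph_one] by simp
qed

text \<open>Division with remainder by a monic polynomial needs ring operations only, so it can be carried
  out simultaneously in both coordinates.\<close>
lemma graph_polys_division:
  assumes PQ: "(P, Q) \<in> graph_polys G" "lead_coeff P = 1" "Polynomial.degree P > 0"
    and "(A, B) \<in> graph_polys G"
  shows "\<exists>A1 B1 A2 B2. (A1, B1) \<in> graph_polys G \<and> (A2, B2) \<in> graph_polys G \<and>
    A = P * A1 + A2 \<and> B = Q * B1 + B2 \<and> Polynomial.degree A2 < Polynomial.degree P"
  using assms(4)
proof (induction "Polynomial.degree A" arbitrary: A B rule: less_induct)
  case less
  note AB = \<open>(A, B) \<in> graph_polys G\<close>
  let ?n = "Polynomial.degree A" and ?d = "Polynomial.degree P"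
  show ?case
  proof (cases "?n < ?d")
    case True
    thus ?thesis using AB graph_polys_zero
      by (intro exI[of _ 0] exI[of _ A] exI[of _ B]) auto
  next
    case False
    define M where "M = Polynomial.monom (poly.coeff A ?n) (?n - ?d)"
    define M' where "M' = Polynomial.monom (poly.coeff B ?n) (?n - ?d)"
    have M: "(M, M') \<in> graph_polys G"
      unfolding M_def M'_def using AB by (intro graph_polys_monom) (auto simp: graph_polys_def)
    have "Polynomial.degree (P * M) \<le> ?n"
      using degree_mult_le[of P M] degree_monom_le[of "poly.coeff A ?n" "?n - ?d"] False
      unfolding M_def by linarith
    hence "Polynomial.degree (A - P * M) \<le> ?n" by (intro degree_diff_le) auto
    moreover have "poly.coeff (A - P * M) ?n = 0"
      using False PQ(2) by (simp add: M_def mult.commute[of P] coeff_monom_mult)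
    ultimately have "Polynomial.degree (A - P * M) < ?n"
      using False PQ(3) eq_zero_or_degree_less[of "A - P * M" ?n] by auto
    moreover have "(A - P * M, B - Q * M') \<in> graph_polys G"
      using AB PQ M by (intro graph_polys_diff graph_polys_mult)
    ultimately obtain A1 B1 A2 B2 where 1: "(A1, B1) \<in> graph_polys G" "(A2, B2) \<in> graph_polys G"
      "A - P * M = P * A1 + A2" "B - Q * M' = Q * B1 + B2" "Polynomial.degree A2 < ?d"
      using less.hyps by blast
    have "A = P * (A1 + M) + A2" "B = Q * (B1 + M') + B2"
      using 1(3,4) by (simp_all add: algebra_simps)
    thus ?thesis using 1 M graph_polys_add by blast
  qed
qed

lemma degree_minimal_root_pair:
  assumes "minimal_root_pair G s P Q"
  shows "Polynomial.degree P > 0"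
proof (rule Nat.gr0I)
  assume "Polynomial.degree P = 0"
  then obtain c where "P = [:c:]" by (rule degree_eq_zeroE)
  thus False using assms by (auto simp: minimal_root_pair_def)
qed

lemma minimal_root_pair_dvd:
  assumes PQ: "minimal_root_pair G s P Q" and AB: "(A, B) \<in> graph_polys G" "poly A s = 0"
  shows "\<exists>A1 B1. (A1, B1) \<in> graph_polys G \<and> A = P * A1 \<and> B = Q * B1"
proof -
  obtain A1 B1 A2 B2 where 1: "(A1, B1) \<in> graph_polys G" "(A2, B2) \<in> graph_polys G"
    "A = P * A1 + A2" "B = Q * B1 + B2" "Polynomial.degree A2 < Polynomial.degree P"
    using graph_polys_division[OF _ _ degree_minimal_root_pair[OF PQ] AB(1), of Q] PQ
    unfolding minimal_root_pair_def by blast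
  have "poly A2 s = 0" using 1(3) AB(2) PQ by (simp add: minimal_root_pair_def)
  hence "A2 = 0" using 1(2,5) PQ by (auto simp: minimal_root_pair_def not_le[symmetric])
  moreover from this have "B2 = 0" using graph_polys_zero_iff[OF 1(2)] by simp
  ultimately show ?thesis using 1 by auto
qed

lemma minimal_root_pair_exists:
  assumes inv: "inverse_closed G" and AB: "(A, B) \<in> graph_polys G" "A \<noteq> 0" "poly A s = 0"
  shows "\<exists>P Q. minimal_root_pair G s P Q"
proof -
  define R where "R = (\<lambda>(A, B). (A, B) \<in> graph_polys G \<and> A \<noteq> 0 \<and> poly A s = 0)"
  have "R (A, B)" using AB by (simp add: R_def)
  then obtain AB' where AB': "R AB'" "\<And>Z. R Z \<Longrightarrow> Polynomial.degree (fst AB') \<le> Polynomial.degree (fst Z)"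
    using ex_has_least_nat[of R _ "\<lambda>Z. Polynomial.degree (fst Z)"] by blast
  obtain A' B' where [simp]: "AB' = (A', B')" by (cases AB')
  have A': "(A', B') \<in> graph_polys G" "A' \<noteq> 0" "poly A' s = 0" using AB'(1) by (auto simp: R_def)
  have "(lead_coeff A', lead_coeff B') \<in> G"
    using A'(1) graph_polys_degree[OF A'(1)] by (auto simp: graph_polys_def)
  hence "(inverse (lead_coeff A'), inverse (lead_coeff B')) \<in> G"
    using inv by (auto simp: inverse_closed_def)
  hence "([:inverse (lead_coeff A'):] * A', [:inverse (lead_coeff B'):] * B') \<in> graph_polys G"
    using A'(1) by (intro graph_polys_mult graph_polys_const)
  hence "minimal_root_pair G s (smult (inverse (lead_coeff A')) A') (smult (inverse (lead_coeff B')) B')"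
    using A' AB'(2) by (auto simp: minimal_root_pair_def R_def)
  thus ?thesis by blast
qed

end

lemma graph_polys_converse: "(B, A) \<in> graph_polys (G\<inverse>) \<longleftrightarrow> (A, B) \<in> graph_polys G"
  by (auto simp: graph_polys_def)

text \<open>The image \<open>Q\<close> of a minimal polynomial \<open>P\<close> is again a minimal polynomial, of any of its roots: the
  minimal polynomial of \<open>s'\<close> divides \<open>Q\<close>, the corresponding factorisation of \<open>P\<close> has a factor that
  vanishes at \<open>s\<close>, and by minimality of \<open>P\<close> this factor has full degree.\<close>
lemma minimal_root_pair_converse:
  assumes G: "hom_graph G" "inverse_closed G" and PQ: "minimal_root_pair G s P Q" "poly Q s' = 0"
  shows "minimal_root_pair (G\<inverse>) s' Q P"
proof -
  have G': "hom_graph (G\<inverse>)" "inverse_closed (G\<inverse>)"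
    using hom_graph_converse[OF G(1)] G(2) by (auto simp: inverse_closed_def)
  have PQ': "(P, Q) \<in> graph_polys G" "(Q, P) \<in> graph_polys (G\<inverse>)" "lead_coeff P = 1" "lead_coeff Q = 1"
    using PQ(1) graph_polys_lead_coeff[OF G(1)] by (auto simp: minimal_root_pair_def graph_polys_converse)
  have "Q \<noteq> 0" using PQ'(4) by auto
  obtain Q2 P2 where 2: "minimal_root_pair (G\<inverse>) s' Q2 P2"
    using minimal_root_pair_exists[OF G' PQ'(2) \<open>Q \<noteq> 0\<close> PQ(2)] by blast
  obtain Q3 P3 where 3: "(Q3, P3) \<in> graph_polys (G\<inverse>)" "Q = Q2 * Q3" "P = P2 * P3"
    using minimal_root_pair_dvd[OF G'(1) 2 PQ'(2) PQ(2)] by blast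
  have P0: "P2 \<noteq> 0" "P3 \<noteq> 0" using 3(3) PQ'(3) by auto
  have G2: "(P2, Q2) \<in> graph_polys G" "(P3, Q3) \<in> graph_polys G"
    using 2 3 by (auto simp: minimal_root_pair_def graph_polys_converse)
  have deg: "Polynomial.degree P2 = Polynomial.degree Q2" "Polynomial.degree P = Polynomial.degree Q"
    using graph_polys_degree[OF G(1)] G2 PQ' by auto
  have "Polynomial.degree Q2 > 0" by (rule degree_minimal_root_pair[OF G'(1) 2])
  have "poly P2 s = 0 \<or> poly P3 s = 0" using PQ(1) 3(3) by (auto simp: minimal_root_pair_def)
  hence "Polynomial.degree P \<le> Polynomial.degree P2 \<or> Polynomial.degree P \<le> Polynomial.degree P3"
    using PQ(1) G2 P0 by (auto simp: minimal_root_pair_def)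
  moreover have "Polynomial.degree P = Polynomial.degree P2 + Polynomial.degree P3"
    using P0 by (simp add: 3(3) degree_mult_eq)
  ultimately have "Polynomial.degree Q \<le> Polynomial.degree Q2"
    using deg \<open>Polynomial.degree Q2 > 0\<close> by auto
  thus ?thesis using 2 PQ' PQ(2) unfolding minimal_root_pair_def by (meson order_trans)
qed

text \<open>The extension sends \<open>A(s)\<close> to \<open>B(s')\<close> for each pair \<open>(A, B)\<close>. That it is well defined and
  injective is divisibility by the minimal polynomial, in the first coordinate for \<open>s\<close> and in the
  second one for \<open>s'\<close>.\<close>
lemma hom_graph_adjoin_root:
  assumes G: "hom_graph G" "inverse_closed G" and PQ: "minimal_root_pair G s P Q" "poly Q s' = 0"
  shows "\<exists>G'. hom_graph G' \<and> G \<subseteq> G' \<and> (s, s') \<in> G'"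
proof -
  define G' where "G' = (\<lambda>(A, B). (poly A s, poly B s')) ` graph_polys G"
  note conv = hom_graph_converse[OF G(1)] minimal_root_pair_converse[OF G PQ]
  have zero: "poly A s = 0 \<longleftrightarrow> poly B s' = 0" if "(A, B) \<in> graph_polys G" for A B
    using minimal_root_pair_dvd[OF G(1) PQ(1) that] minimal_root_pair_dvd[OF conv, of B A] that PQ
    by (auto simp: graph_polys_converse minimal_root_pair_def)
  have mem: "(poly A s, poly B s') \<in> G'" if "(A, B) \<in> graph_polys G" for A B
    using that by (force simp: G'_def)
  have "hom_graph G'"
    unfolding hom_graph_def
  proof (intro conjI allI impI)
    show "(1, 1) \<in> G'" using mem[OF graph_polys_const[OF G(1) hom_graph_one[OF G(1)]]] by simp
  next
    fix x y x' y' assume "(x, y) \<in> G'" "(x', y') \<in> G'"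
    then obtain A B A' B' where AB: "(A, B) \<in> graph_polys G" "(A', B') \<in> graph_polys G"
      "x = poly A s" "y = poly B s'" "x' = poly A' s" "y' = poly B' s'" by (auto simp: G'_def)
    show "(x + x', y + y') \<in> G'" using mem[OF graph_polys_add[OF G(1) AB(1,2)]] AB by simp
    show "(x * x', y * y') \<in> G'" using mem[OF graph_polys_mult[OF G(1) AB(1,2)]] AB by simp
  next
    fix x y assume "(x, y) \<in> G'"
    then obtain A B where AB: "(A, B) \<in> graph_polys G" "x = poly A s" "y = poly B s'"
      by (auto simp: G'_def)
    show "(- x, - y) \<in> G'" using mem[OF graph_polys_minus[OF G(1) AB(1)]] AB by simp
    show "x = 0 \<longleftrightarrow> y = 0" using zero AB by auto
  qed
  moreover have "G \<subseteq> G'" using mem[OF graph_polys_const[OF G(1)]] by fastforce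
  moreover have "(s, s') \<in> G'"
    using mem[OF graph_polys_monom[OF G(1) hom_graph_one[OF G(1)], of 1]] by (simp add: poly_monom)
  ultimately show ?thesis by blast
qed

text \<open>Passing to quotients shows that the domain of a maximal graph is a field.\<close>
lemma hom_graph_fractions:
  assumes G: "hom_graph G"
  shows "\<exists>G'. hom_graph G' \<and> G \<subseteq> G' \<and> (\<forall>x y. (x, y) \<in> G \<longrightarrow> (inverse x, inverse y) \<in> G')"
proof -
  define G' where "G' = {(x / z, y / w) | x y z w. (x, y) \<in> G \<and> (z, w) \<in> G \<and> z \<noteq> 0}"
  note G_simps = hom_graph_add[OF G] hom_graph_mult[OF G] hom_graph_minus[OF G] hom_graph_one[OF G]
  have mem: "(x / z, y / w) \<in> G'" if "(x, y) \<in> G" "(z, w) \<in> G" "z \<noteq> 0" for x y z w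
    using that by (auto simp: G'_def)
  have "hom_graph G'"
    unfolding hom_graph_def
  proof (intro conjI allI impI)
    show "(1, 1) \<in> G'" using mem[of 1 1 1 1] G_simps by simp
  next
    fix a b a' b' assume "(a, b) \<in> G'" "(a', b') \<in> G'"
    then obtain x y z w x' y' z' w' where 1: "(x, y) \<in> G" "(z, w) \<in> G" "z \<noteq> 0" "a = x / z" "b = y / w"
      "(x', y') \<in> G" "(z', w') \<in> G" "z' \<noteq> 0" "a' = x' / z'" "b' = y' / w'"
      unfolding G'_def by blast
    have "w \<noteq> 0" "w' \<noteq> 0" using 1 hom_graph_zero_iff[OF G] by blast+
    thus "(a + a', b + b') \<in> G'" "(a * a', b * b') \<in> G'"
      using mem[of "x * z' + x' * z" "y * w' + y' * w" "z * z'" "w * w'"]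
        mem[of "x * x'" "y * y'" "z * z'" "w * w'"] 1 G_simps by (auto simp: add_frac_eq)
  next
    fix a b assume "(a, b) \<in> G'"
    then obtain x y z w where 1: "(x, y) \<in> G" "(z, w) \<in> G" "z \<noteq> 0" "a = x / z" "b = y / w"
      unfolding G'_def by blast
    show "(- a, - b) \<in> G'" using mem[of "- x" "- y" z w] 1 G_simps by simp
    show "a = 0 \<longleftrightarrow> b = 0" using 1 hom_graph_zero_iff[OF G] by auto
  qed
  moreover have "G \<subseteq> G'" using mem[of _ _ 1 1] G_simps by auto
  moreover have "(inverse x, inverse y) \<in> G'" if "(x, y) \<in> G" for x y
  proof (cases "x = 0")
    case True
    thus ?thesis using that hom_graph_zero_iff[OF G that] \<open>G \<subseteq> G'\<close> by auto
  next
    case False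
    thus ?thesis using mem[of 1 1 x y] that G_simps by (simp add: inverse_eq_divide)
  qed
  ultimately show ?thesis by blast
qed

text \<open>A field homomorphism into \<open>\<complex>\<close> whose domain \<open>D\<close> contains every algebraic number.\<close>
locale algebraic_embedding =
  fixes D :: "complex set" and \<sigma> :: "complex \<Rightarrow> complex"
  assumes algebraic_in: "algebraic x \<Longrightarrow> x \<in> D"
    and add_in: "x \<in> D \<Longrightarrow> y \<in> D \<Longrightarrow> x + y \<in> D"
    and mult_in: "x \<in> D \<Longrightarrow> y \<in> D \<Longrightarrow> x * y \<in> D"
    and inverse_in: "x \<in> D \<Longrightarrow> inverse x \<in> D"
    and hom_one: "\<sigma> 1 = 1"
    and hom_add: "x \<in> D \<Longrightarrow> y \<in> D \<Longrightarrow> \<sigma> (x + y) = \<sigma> x + \<sigma> y"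
    and hom_mult: "x \<in> D \<Longrightarrow> y \<in> D \<Longrightarrow> \<sigma> (x * y) = \<sigma> x * \<sigma> y"

text \<open>A maximal extension given by Zorn's lemma is defined at every algebraic number, since otherwise a
  root could be adjoined.\<close>
lemma algebraic_embedding_extends_hom_graph:
  assumes "hom_graph G"
  shows "\<exists>D \<sigma>. algebraic_embedding D \<sigma> \<and> (\<forall>(x, y)\<in>G. \<sigma> x = y)"
proof -
  define \<A> where "\<A> = {G'. hom_graph G' \<and> G \<subseteq> G'}"
  have "\<exists>M\<in>\<A>. \<forall>Z\<in>\<A>. M \<subseteq> Z \<longrightarrow> Z = M"
  proof (rule subset_Zorn_nonempty)
    show "\<A> \<noteq> {}" using assms by (auto simp: \<A>_def)
    fix \<C> assume C: "\<C> \<noteq> {}" "subset.chain \<A> \<C>"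
    have hom: "hom_graph Z" "G \<subseteq> Z" if "Z \<in> \<C>" for Z
      using C(2) that by (auto simp: \<A>_def subset.chain_def)
    have pair: "\<exists>Z\<in>\<C>. p \<in> Z \<and> q \<in> Z" if "p \<in> \<Union>\<C>" "q \<in> \<Union>\<C>" for p q
    proof -
      obtain Y Z where YZ: "Y \<in> \<C>" "p \<in> Y" "Z \<in> \<C>" "q \<in> Z" using \<open>p \<in> _\<close> \<open>q \<in> _\<close> by blast
      hence "Y \<subseteq> Z \<or> Z \<subseteq> Y" using C(2) by (auto simp: subset.chain_def)
      thus ?thesis using YZ by blast
    qed
    have "hom_graph (\<Union>\<C>)"
      unfolding hom_graph_def
    proof (intro conjI allI impI)
      show "(1, 1) \<in> \<Union>\<C>" using C(1) hom hom_graph_one by blast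
    next
      fix x y x' y' assume "(x, y) \<in> \<Union>\<C>" "(x', y') \<in> \<Union>\<C>"
      then obtain Z where Z: "Z \<in> \<C>" "(x, y) \<in> Z" "(x', y') \<in> Z" using pair by blast
      show "(x + x', y + y') \<in> \<Union>\<C>" using Z hom_graph_add[OF hom(1)] by blast
      show "(x * x', y * y') \<in> \<Union>\<C>" using Z hom_graph_mult[OF hom(1)] by blast
    next
      fix x y assume "(x, y) \<in> \<Union>\<C>"
      then obtain Z where Z: "Z \<in> \<C>" "(x, y) \<in> Z" by blast
      show "(- x, - y) \<in> \<Union>\<C>" using Z hom_graph_minus[OF hom(1)] by blast
      show "x = 0 \<longleftrightarrow> y = 0" using Z hom_graph_zero_iff[OF hom(1)] by blast
    qed
    thus "\<Union>\<C> \<in> \<A>" using C(1) hom(2) by (auto simp: \<A>_def)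
  qed
  then obtain M where M: "hom_graph M" "G \<subseteq> M" and max: "\<And>Z. hom_graph Z \<Longrightarrow> M \<subseteq> Z \<Longrightarrow> Z = M"
    by (auto simp: \<A>_def)
  have inv: "inverse_closed M"
    using hom_graph_fractions[OF M(1)] max unfolding inverse_closed_def by blast
  have alg: "\<exists>y. (x, y) \<in> M" if x: "algebraic x" for x
  proof -
    obtain p where p: "p \<noteq> 0" "poly (map_poly of_int p) x = 0"
      using x by (rule algebraicE')
    have p': "(map_poly of_int p, map_poly of_int p) \<in> graph_polys M"
      by (auto simp: graph_polys_def coeff_map_poly hom_graph_of_int[OF M(1)])
    have "map_poly of_int p \<noteq> (0 :: complex poly)" using p(1) by simp
    then obtain P Q where PQ: "minimal_root_pair M x P Q"
      using minimal_root_pair_exists[OF M(1) inv p'] p(2) by blast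
    have "Polynomial.degree Q > 0"
      using degree_minimal_root_pair[OF M(1) PQ] graph_polys_degree[OF M(1)] PQ
      by (auto simp: minimal_root_pair_def)
    then obtain y where "poly Q y = 0" using alg_closed_imp_poly_has_root by blast
    thus ?thesis using hom_graph_adjoin_root[OF M(1) inv PQ] max by blast
  qed
  define \<sigma> where "\<sigma> = (\<lambda>x. THE y. (x, y) \<in> M)"
  have \<sigma>: "\<sigma> x = y" if "(x, y) \<in> M" for x y
    unfolding \<sigma>_def using that hom_graph_single_valued[OF M(1)] by (intro the_equality)
  have "algebraic_embedding (Domain M) \<sigma>"
  proof
    fix x :: complex assume "algebraic x" thus "x \<in> Domain M" using alg by blast
  next
    show "\<sigma> 1 = 1" by (rule \<sigma>[OF hom_graph_one[OF M(1)]])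
  next
    fix x assume "x \<in> Domain M" thus "inverse x \<in> Domain M"
      using inv unfolding inverse_closed_def by blast
  next
    fix x y assume "x \<in> Domain M" "y \<in> Domain M"
    then obtain x' y' where *: "(x, x') \<in> M" "(y, y') \<in> M" by blast
    note sum = hom_graph_add[OF M(1) *] and prod = hom_graph_mult[OF M(1) *]
    show "x + y \<in> Domain M" "x * y \<in> Domain M" using sum prod by blast+
    show "\<sigma> (x + y) = \<sigma> x + \<sigma> y" "\<sigma> (x * y) = \<sigma> x * \<sigma> y"
      using \<sigma>[OF sum] \<sigma>[OF prod] \<sigma>[OF *(1)] \<sigma>[OF *(2)] by simp_all
  qed
  thus ?thesis using \<sigma> M(2) by (intro exI[of _ "Domain M"] exI[of _ \<sigma>]) auto
qed

text \<open>The minimal polynomial of an irrational algebraic number has another root, because it is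
  separable; send \<open>x\<close> to that root and extend.\<close>
theorem algebraic_embedding_moves_irrational:
  assumes "algebraic x" "x \<notin> \<rat>"
  shows "\<exists>D \<sigma>. algebraic_embedding D \<sigma> \<and> \<sigma> x \<noteq> x"
proof -
  define G where "G = {(q, q) | q. q \<in> (\<rat> :: complex set)}"
  have G: "hom_graph G" "inverse_closed G" by (auto simp: G_def hom_graph_def inverse_closed_def)
  have PG: "(A, B) \<in> graph_polys G \<longleftrightarrow> A = B \<and> (\<forall>i. poly.coeff A i \<in> \<rat>)" for A B
    by (auto simp: graph_polys_def G_def poly_eq_iff)
  obtain p where p: "p \<noteq> 0" "poly (map_poly of_int p) x = 0"
    using assms(1) by (rule algebraicE')
  have p': "(map_poly of_int p, map_poly of_int p) \<in> graph_polys G"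
    by (auto simp: PG coeff_map_poly)
  have "map_poly of_int p \<noteq> (0 :: complex poly)" using p(1) by simp
  then obtain P Q where PQ: "minimal_root_pair G x P Q"
    using minimal_root_pair_exists[OF G p'] p(2) by blast
  hence [simp]: "Q = P" and P: "lead_coeff P = 1" "\<And>i. poly.coeff P i \<in> \<rat>" "poly P x = 0"
    by (auto simp: minimal_root_pair_def PG)
  note deg = degree_minimal_root_pair[OF G(1) PQ]
  obtain R where R: "P = [:- x, 1:] * R" using P(3) by (auto simp: poly_eq_0_iff_dvd)
  have R0: "R \<noteq> 0" using P(1) R by auto
  have lR: "lead_coeff R = 1" using P(1) unfolding R lead_coeff_mult by simp
  have "Polynomial.degree R > 0"
  proof (rule Nat.gr0I)
    assume "Polynomial.degree R = 0"
    then obtain c where "R = [:c:]" by (rule degree_eq_zeroE)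
    hence "P = [:- x, 1:]" using R lR by simp
    hence "- x \<in> \<rat>" using P(2)[of 0] by simp
    thus False using assms(2) by simp
  qed
  then obtain z where z: "poly R z = 0" using alg_closed_imp_poly_has_root by blast
  \<comment> \<open>A double root \<open>x\<close> would be a root of the derivative, which is rational of smaller degree.\<close>
  have "z \<noteq> x"
  proof
    assume "z = x"
    hence "poly (pderiv P) x = 0" using z unfolding R pderiv_mult by simp
    moreover have "(pderiv P, pderiv P) \<in> graph_polys G"
      using P(2) by (auto simp: PG coeff_pderiv intro!: Rats_mult)
    moreover have "pderiv P \<noteq> 0" using deg by (simp add: pderiv_eq_0_iff)
    ultimately have "Polynomial.degree P \<le> Polynomial.degree (pderiv P)"
      using PQ unfolding minimal_root_pair_def by blast
    thus False using deg by (simp add: degree_pderiv)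
  qed
  have "poly Q z = 0" using z by (simp add: R)
  then obtain G' where "hom_graph G'" "(x, z) \<in> G'"
    using hom_graph_adjoin_root[OF G PQ] by blast
  then obtain D \<sigma> where "algebraic_embedding D \<sigma>" "\<forall>(x, y)\<in>G'. \<sigma> x = y"
    using algebraic_embedding_extends_hom_graph by blast
  moreover from this have "\<sigma> x = z" using \<open>(x, z) \<in> G'\<close> by auto
  ultimately show ?thesis using \<open>z \<noteq> x\<close> by blast
qed

section \<open>Embeddings restrict to Galois groups\<close>

context algebraic_embedding
begin

lemma zero_in: "0 \<in> D" and one_in: "1 \<in> D"
  by (rule algebraic_in, simp)+

lemma minus_in: "x \<in> D \<Longrightarrow> - x \<in> D"
  using mult_in[OF algebraic_in[of "-1"]] by simp

lemma diff_in: "x \<in> D \<Longrightarrow> y \<in> D \<Longrightarrow> x - y \<in> D"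
  using add_in[OF _ minus_in] by simp

lemma prod_in: "(\<And>i. i \<in> I \<Longrightarrow> f i \<in> D) \<Longrightarrow> (\<Prod>i\<in>I. f i) \<in> D"
  by (induction I rule: infinite_finite_induct) (auto intro: mult_in one_in)

lemma hom_zero: "\<sigma> 0 = 0"
  using hom_add[OF zero_in zero_in] by simp

lemma hom_minus: "x \<in> D \<Longrightarrow> \<sigma> (- x) = - \<sigma> x"
  using hom_add[OF _ minus_in, of x x] hom_zero by (simp add: eq_neg_iff_add_eq_0 add.commute)

lemma hom_diff: "x \<in> D \<Longrightarrow> y \<in> D \<Longrightarrow> \<sigma> (x - y) = \<sigma> x - \<sigma> y"
  using hom_add[OF _ minus_in, of x y] hom_minus by simp

lemma hom_inverse: "x \<in> D \<Longrightarrow> \<sigma> (inverse x) = inverse (\<sigma> x)"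
  using hom_mult[OF _ inverse_in, of x x] hom_one hom_zero
  by (cases "x = 0") (auto dest: inverse_unique)

lemma hom_eq_zero: "x \<in> D \<Longrightarrow> \<sigma> x = 0 \<Longrightarrow> x = 0"
  using hom_mult[OF _ inverse_in, of x x] hom_one by (cases "x = 0") auto

lemma inj_on_hom: "inj_on \<sigma> D"
proof (rule inj_onI)
  fix x y assume *: "x \<in> D" "y \<in> D" "\<sigma> x = \<sigma> y"
  hence "\<sigma> (x - y) = 0" by (simp add: hom_diff)
  thus "x = y" using hom_eq_zero[OF diff_in[OF *(1,2)]] by simp
qed

lemma hom_prod: "(\<And>i. i \<in> I \<Longrightarrow> f i \<in> D) \<Longrightarrow> \<sigma> (\<Prod>i\<in>I. f i) = (\<Prod>i\<in>I. \<sigma> (f i))"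
  by (induction I rule: infinite_finite_induct) (auto simp: hom_one hom_mult prod_in)

lemma hom_of_nat: "\<sigma> (of_nat n) = of_nat n"
  by (induction n) (auto simp: hom_zero hom_one hom_add algebraic_in)

lemma hom_of_int: "\<sigma> (of_int n) = of_int n"
  by (cases n) (auto simp: hom_of_nat hom_minus algebraic_in simp del: of_nat_Suc)

lemma algebraic_int_in: "algebraic_int x \<Longrightarrow> x \<in> D"
  by (intro algebraic_in algebraic_int_imp_algebraic)

lemma of_nat_diff_in: "x \<in> D \<Longrightarrow> of_nat n - x \<in> D"
  by (rule diff_in[OF algebraic_in]) simp_all

lemma hom_of_nat_diff: "x \<in> D \<Longrightarrow> \<sigma> (of_nat n - x) = of_nat n - \<sigma> x"
  by (simp add: hom_diff hom_of_nat algebraic_in)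

lemma hom_Rats: "x \<in> \<rat> \<Longrightarrow> \<sigma> x = x"
  by (elim Rats_cases')
    (simp add: divide_inverse hom_mult hom_inverse hom_of_int inverse_in algebraic_in)

lemma hom_poly_of_int: "x \<in> D \<Longrightarrow> \<sigma> (poly (map_poly of_int p) x) = poly (map_poly of_int p) (\<sigma> x)
    \<and> poly (map_poly of_int p) x \<in> D"
  by (induction p)
    (auto simp: map_poly_pCons hom_zero zero_in hom_add hom_mult hom_of_int algebraic_in add_in mult_in)

end

lemma algebraic_embedding_cnj: "algebraic_embedding UNIV cnj"
  by unfold_locales auto

text \<open>The source of every integer in the counting argument.\<close>
lemma integer_if_fixed_by_embeddings:
  assumes "algebraic_int x" "\<And>D \<sigma>. algebraic_embedding D \<sigma> \<Longrightarrow> \<sigma> x = x"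
  shows "(x :: complex) \<in> \<int>"
  using assms algebraic_embedding_moves_irrational rational_algebraic_int_is_int
  by (metis algebraic_int_imp_algebraic)

lemma complex_ring_simps:
  "carrier complex_ring = UNIV" "x \<otimes>\<^bsub>complex_ring\<^esub> y = x * y" "x \<oplus>\<^bsub>complex_ring\<^esub> y = x + y"
  "\<one>\<^bsub>complex_ring\<^esub> = 1" "\<zero>\<^bsub>complex_ring\<^esub> = 0"
  by (simp_all add: ring_of_type_algebra_def)

lemma complex_ring_minus: "\<ominus>\<^bsub>complex_ring\<^esub> x = - x"
proof -
  interpret field complex_ring by (rule field_from_type_algebra)
  show ?thesis using minus_equality[of "- x" x] by (simp add: complex_ring_simps)
qed

lemma complex_ring_inverse: "x \<noteq> 0 \<Longrightarrow> inv\<^bsub>complex_ring\<^esub> x = inverse x"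
proof -
  assume "x \<noteq> 0"
  interpret field complex_ring by (rule field_from_type_algebra)
  show ?thesis using comm_inv_char[of x "inverse x"] \<open>x \<noteq> 0\<close> by (simp add: complex_ring_simps)
qed

lemma adjoin_incl: "h \<in> K \<union> S \<Longrightarrow> h \<in> adjoin K S"
  unfolding adjoin_def by (rule generate_field.incl)

lemma adjoin_minus: "x \<in> adjoin K S \<Longrightarrow> - x \<in> adjoin K S"
  and adjoin_inverse: "x \<in> adjoin K S \<Longrightarrow> x \<noteq> 0 \<Longrightarrow> inverse x \<in> adjoin K S"
  and adjoin_add: "x \<in> adjoin K S \<Longrightarrow> y \<in> adjoin K S \<Longrightarrow> x + y \<in> adjoin K S"
  and adjoin_mult: "x \<in> adjoin K S \<Longrightarrow> y \<in> adjoin K S \<Longrightarrow> x * y \<in> adjoin K S"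
  and adjoin_one: "1 \<in> adjoin K S"
  unfolding adjoin_def
  using generate_field.intros[where R = complex_ring and H = "K \<union> S",
      unfolded complex_ring_simps complex_ring_minus] complex_ring_inverse by auto

lemma adjoin_induct [consumes 1, case_names one incl minus inverse add mult]:
  assumes "x \<in> adjoin K S" "P 1" "\<And>h. h \<in> K \<union> S \<Longrightarrow> P h" "\<And>h. P h \<Longrightarrow> P (- h)"
    "\<And>h. h \<noteq> 0 \<Longrightarrow> P h \<Longrightarrow> P (inverse h)" "\<And>h k. P h \<Longrightarrow> P k \<Longrightarrow> P (h + k)"
    "\<And>h k. P h \<Longrightarrow> P k \<Longrightarrow> P (h * k)"
  shows "P x"
  using assms(1) unfolding adjoin_def
  by (induction rule: generate_field.induct)
    (simp_all add: assms(2-) complex_ring_simps complex_ring_minus complex_ring_inverse)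

lemma finite_root_set: "f \<noteq> 0 \<Longrightarrow> finite (root_set f)"
  unfolding root_set_def by (rule poly_roots_finite) simp

lemma algebraic_root_set: "f \<noteq> 0 \<Longrightarrow> \<alpha> \<in> root_set f \<Longrightarrow> algebraic \<alpha>"
  unfolding root_set_def
  by (rule algebraicI[of "map_poly of_int f"]) (auto simp: coeff_map_poly)

context algebraic_embedding
begin

lemma hom_image_root_set:
  assumes "f \<noteq> 0"
  shows "\<sigma> ` root_set f = root_set f"
proof (rule endo_inj_surj[OF finite_root_set[OF assms]])
  have D: "root_set f \<subseteq> D" using algebraic_root_set[OF assms] algebraic_in by blast
  show "\<sigma> ` root_set f \<subseteq> root_set f"
  proof
    fix y assume "y \<in> \<sigma> ` root_set f"
    then obtain x where x: "x \<in> D" "poly (map_poly of_int f) x = 0" "y = \<sigma> x"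
      using D by (auto simp: root_set_def)
    thus "y \<in> root_set f" using hom_poly_of_int[OF x(1), of f] hom_zero by (simp add: root_set_def)
  qed
  show "inj_on \<sigma> (root_set f)" by (rule inj_on_subset[OF inj_on_hom D])
qed

text \<open>The splitting field lies in \<open>D\<close> and is mapped onto itself, because its generators are rational
  or permuted.\<close>
lemma splitting_field_closed:
  assumes "f \<noteq> 0" "x \<in> adjoin \<rat> (root_set f)"
  shows "x \<in> D \<and> \<sigma> x \<in> adjoin \<rat> (root_set f) \<and> (\<exists>y \<in> adjoin \<rat> (root_set f) \<inter> D. \<sigma> y = x)"
  using assms(2)
proof (induction rule: adjoin_induct)
  case one
  show ?case using adjoin_one one_in hom_one by auto
next
  case (incl h)
  show ?case
  proof (cases "h \<in> \<rat>")
    case True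
    hence "h \<in> D" using algebraic_in by (auto elim!: Rats_cases' simp: divide_inverse mult_in inverse_in)
    thus ?thesis using True hom_Rats[OF True] adjoin_incl[OF incl] by auto
  next
    case False
    hence h: "h \<in> root_set f" using incl by blast
    have D: "root_set f \<subseteq> D" using algebraic_root_set[OF assms(1)] algebraic_in by blast
    have "h \<in> \<sigma> ` root_set f" using hom_image_root_set[OF assms(1)] h by simp
    then obtain h' where h': "h' \<in> root_set f" "\<sigma> h' = h" by blast
    have "\<sigma> h \<in> root_set f" using hom_image_root_set[OF assms(1)] imageI[OF h, of \<sigma>] by simp
    hence "\<sigma> h \<in> adjoin \<rat> (root_set f)" "h' \<in> adjoin \<rat> (root_set f) \<inter> D" "h \<in> D"
      using h h' D by (auto intro: adjoin_incl)
    thus ?thesis using h' by blast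
  qed
next
  case (minus h)
  thus ?case using adjoin_minus minus_in hom_minus by (metis Int_iff)
next
  case (inverse h)
  moreover from this have "\<sigma> h \<noteq> 0" using hom_eq_zero by blast
  ultimately show ?case using adjoin_inverse inverse_in hom_inverse hom_zero by (metis Int_iff)
next
  case (add h k)
  thus ?case using adjoin_add add_in hom_add by (metis Int_iff)
next
  case (mult h k)
  thus ?case using adjoin_mult mult_in hom_mult by (metis Int_iff)
qed

lemma restrict_in_galois_group:
  assumes "f \<noteq> 0"
  shows "restrict \<sigma> (adjoin \<rat> (root_set f)) \<in> carrier (galois_group f)"
proof -
  let ?L = "adjoin \<rat> (root_set f)"
  note cl = splitting_field_closed[OF assms]
  have "inj_on \<sigma> ?L" using inj_on_hom cl inj_on_subset by blast
  moreover have "\<sigma> ` ?L = ?L" using cl by blast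
  ultimately have "bij_betw (restrict \<sigma> ?L) ?L ?L"
    by (simp add: bij_betw_def inj_on_def)
  hence "restrict \<sigma> ?L \<in> Bij ?L" by (simp add: Bij_def)
  moreover have "\<rat> \<subseteq> ?L" by (auto intro: adjoin_incl)
  moreover have "restrict \<sigma> ?L \<in> Ring.ring_hom (complex_ring\<lparr>carrier := ?L\<rparr>) (complex_ring\<lparr>carrier := ?L\<rparr>)"
    using cl adjoin_add adjoin_mult adjoin_one hom_add hom_mult hom_one
    by (intro ring_hom_memI) (auto simp: complex_ring_simps)
  ultimately show ?thesis using hom_Rats by (auto simp: galois_group_def Gal_def)
qed

end

text \<open>An isomorphism of permutation groups transports the labels \<open>\<Omega>\<close> to the roots, and every
  embedding restricts to an element of the Galois group.\<close>
lemma labelled_roots_permuted_by_group: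
  assumes f: "f \<in> polys_with_group H G \<phi> \<Omega>"
  shows "\<exists>\<alpha>. bij_betw \<alpha> \<Omega> (root_set f) \<and>
    (\<forall>D \<sigma>. algebraic_embedding D \<sigma> \<longrightarrow> (\<exists>g\<in>carrier G. \<forall>A\<in>\<Omega>. \<phi> g A \<in> \<Omega> \<and> \<sigma> (\<alpha> A) = \<alpha> (\<phi> g A)))"
proof -
  have "f \<noteq> 0" using f by (auto simp: polys_with_group_def monic_polys_def)
  obtain h b where h: "h \<in> iso (galois_group f) G" and b: "bij_betw b (root_set f) \<Omega>"
    and hb: "\<And>\<tau> \<omega>. \<tau> \<in> carrier (galois_group f) \<Longrightarrow> \<omega> \<in> root_set f \<Longrightarrow>
      \<phi> (h \<tau>) (b \<omega>) = b (galois_action f \<tau> \<omega>)"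
    using f unfolding polys_with_group_def perm_group_iso_def by blast
  define \<alpha> where "\<alpha> = inv_into (root_set f) b"
  have \<alpha>: "bij_betw \<alpha> \<Omega> (root_set f)" unfolding \<alpha>_def by (rule bij_betw_inv_into[OF b])
  have "\<exists>g\<in>carrier G. \<forall>A\<in>\<Omega>. \<phi> g A \<in> \<Omega> \<and> \<sigma> (\<alpha> A) = \<alpha> (\<phi> g A)" if "algebraic_embedding D \<sigma>" for D \<sigma>
  proof -
    interpret algebraic_embedding D \<sigma> by (rule that)
    let ?\<tau> = "restrict \<sigma> (adjoin \<rat> (root_set f))"
    have \<tau>: "?\<tau> \<in> carrier (galois_group f)" by (rule restrict_in_galois_group[OF \<open>f \<noteq> 0\<close>])
    have "\<phi> (h ?\<tau>) A \<in> \<Omega> \<and> \<sigma> (\<alpha> A) = \<alpha> (\<phi> (h ?\<tau>) A)" if A: "A \<in> \<Omega>" for A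
    proof -
      have \<alpha>A: "\<alpha> A \<in> root_set f" "b (\<alpha> A) = A"
        using \<alpha> b A by (auto simp: bij_betw_def \<alpha>_def f_inv_into_f)
      have "\<alpha> A \<in> adjoin \<rat> (root_set f)" using \<alpha>A by (auto intro: adjoin_incl)
      hence "\<phi> (h ?\<tau>) A = b (\<sigma> (\<alpha> A))" using hb[OF \<tau> \<alpha>A(1)] \<alpha>A by (simp add: galois_action_def)
      moreover have "\<sigma> (\<alpha> A) \<in> root_set f" using hom_image_root_set[OF \<open>f \<noteq> 0\<close>] \<alpha>A by blast
      ultimately show ?thesis using b by (auto simp: bij_betw_def \<alpha>_def)
    qed
    moreover have "h ?\<tau> \<in> carrier G" using h \<tau> by (auto simp: iso_def hom_def)
    ultimately show ?thesis by blast
  qed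
  thus ?thesis using \<alpha> by blast
qed

section \<open>A compatible family of algebraic integers is determined by approximations\<close>

text \<open>The values at \<open>z\<close> and at \<open>cnj z\<close> together locate \<open>z\<close> up to distance less than \<open>1\<close>. One integer
  per member is therefore enough for a family closed under complex conjugation; recording real and
  imaginary parts separately would double the exponent of \<open>H\<close>.\<close>
definition bucket :: "complex \<Rightarrow> int" where
  "bucket z = \<lfloor>4 * (Re z + Im z)\<rfloor>"

lemma norm_diff_less_1_if_bucket_eq:
  assumes "bucket z = bucket w" "bucket (cnj z) = bucket (cnj w)"
  shows "cmod (z - w) < 1"
proof -
  have floor: "\<bar>a - b\<bar> < 1 / 4" if "\<lfloor>4 * a\<rfloor> = \<lfloor>4 * b\<rfloor>" for a b :: real
    using that by linarith
  have "\<bar>(Re z + Im z) - (Re w + Im w)\<bar> < 1 / 4" "\<bar>(Re z - Im z) - (Re w - Im w)\<bar> < 1 / 4"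
    using floor[of "Re z + Im z" "Re w + Im w"] floor[of "Re z - Im z" "Re w - Im w"] assms
    by (simp_all add: bucket_def)
  hence "\<bar>Re z - Re w\<bar> + \<bar>Im z - Im w\<bar> < 1" by linarith
  thus ?thesis using cmod_le[of "z - w"] by simp
qed

lemma bucket_bound: "\<bar>bucket z\<bar> \<le> 9 * max 1 (cmod z)"
proof -
  have "\<bar>Re z\<bar> \<le> cmod z" "\<bar>Im z\<bar> \<le> cmod z" by (rule abs_Re_le_cmod, rule abs_Im_le_cmod)
  moreover have "\<bar>real_of_int \<lfloor>4 * (Re z + Im z)\<rfloor>\<bar> \<le> \<bar>4 * (Re z + Im z)\<bar> + 1" by linarith
  moreover have "\<bar>4 * (Re z + Im z)\<bar> \<le> 4 * \<bar>Re z\<bar> + 4 * \<bar>Im z\<bar>"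
    using abs_triangle_ineq[of "Re z" "Im z"] by (simp add: abs_mult)
  moreover have "cmod z \<le> max 1 (cmod z)" "1 \<le> max 1 (cmod z)" by simp_all
  ultimately show ?thesis unfolding bucket_def of_int_abs by linarith
qed

text \<open>The rigidity of algebraic integers. The set of indices where \<open>x\<close> and \<open>x'\<close> differ is
  stable under every \<open>\<pi>\<close>, so the product of the differences over this set is fixed by all embeddings:
  it is a nonzero integer. All differences are less than \<open>1\<close> in absolute value, by the buckets and the
  embedding \<open>cnj\<close>.\<close>
lemma eq_if_buckets_eq:
  fixes x x' :: "'j \<Rightarrow> complex"
  assumes "finite J"
    and alg: "\<And>j. j \<in> J \<Longrightarrow> algebraic_int (x j)" "\<And>j. j \<in> J \<Longrightarrow> algebraic_int (x' j)"
    and perm: "\<And>D \<sigma>. algebraic_embedding D \<sigma> \<Longrightarrow>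
      \<exists>\<pi>. bij_betw \<pi> J J \<and> (\<forall>j\<in>J. \<sigma> (x j) = x (\<pi> j) \<and> \<sigma> (x' j) = x' (\<pi> j))"
    and bucket: "\<And>j. j \<in> J \<Longrightarrow> bucket (x j) = bucket (x' j)"
    and "j \<in> J"
  shows "x j = x' j"
proof (rule ccontr)
  assume "x j \<noteq> x' j"
  define d where "d = (\<lambda>i. x i - x' i)"
  define S where "S = {i \<in> J. d i \<noteq> 0}"
  have S: "finite S" "S \<subseteq> J" "j \<in> S"
    using \<open>x j \<noteq> x' j\<close> assms(1) \<open>j \<in> J\<close> by (auto simp: S_def d_def)
  have alg_d: "algebraic_int (d i)" if "i \<in> J" for i
    using alg that by (simp add: d_def algebraic_int_diff)
  have small: "cmod (d i) < 1" if "i \<in> J" for i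
  proof -
    obtain \<pi> where \<pi>: "bij_betw \<pi> J J" "\<And>i. i \<in> J \<Longrightarrow> cnj (x i) = x (\<pi> i) \<and> cnj (x' i) = x' (\<pi> i)"
      using perm[OF algebraic_embedding_cnj] by blast
    have "\<pi> i \<in> J" using \<pi>(1) that by (auto simp: bij_betw_def)
    thus ?thesis unfolding d_def
      using bucket[OF that] bucket[of "\<pi> i"] \<pi>(2)[OF that]
      by (intro norm_diff_less_1_if_bucket_eq) simp_all
  qed
  have "(\<Prod>i\<in>S. d i) \<in> \<int>"
  proof (rule integer_if_fixed_by_embeddings)
    show "algebraic_int (\<Prod>i\<in>S. d i)" using S alg_d by (auto intro!: algebraic_int_prod)
    fix D \<sigma> assume emb: "algebraic_embedding D \<sigma>"
    interpret algebraic_embedding D \<sigma> by (rule emb)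
    obtain \<pi> where \<pi>: "bij_betw \<pi> J J" "\<And>i. i \<in> J \<Longrightarrow> \<sigma> (x i) = x (\<pi> i) \<and> \<sigma> (x' i) = x' (\<pi> i)"
      using perm[OF emb] by blast
    have inD: "x i \<in> D" "x' i \<in> D" "d i \<in> D" if "i \<in> J" for i
      using alg alg_d that by (simp_all add: algebraic_int_in)
    have \<sigma>d: "\<sigma> (d i) = d (\<pi> i)" if "i \<in> J" for i
      using that inD \<pi>(2) by (simp add: d_def hom_diff)
    have "\<pi> ` S \<subseteq> S"
    proof
      fix i' assume "i' \<in> \<pi> ` S"
      then obtain i where i: "i \<in> J" "d i \<noteq> 0" "i' = \<pi> i" by (auto simp: S_def)
      thus "i' \<in> S" using \<pi>(1) \<sigma>d[of i] hom_eq_zero[OF inD(3)] by (auto simp: S_def bij_betw_def)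
    qed
    moreover have "inj_on \<pi> S" using \<pi>(1) S(2) by (auto simp: bij_betw_def intro: inj_on_subset)
    ultimately have bij: "bij_betw \<pi> S S" using endo_inj_surj[OF S(1)] by (auto simp: bij_betw_def)
    have "\<sigma> (\<Prod>i\<in>S. d i) = (\<Prod>i\<in>S. \<sigma> (d i))" using S(2) inD(3) by (intro hom_prod) auto
    also have "\<dots> = (\<Prod>i\<in>S. d (\<pi> i))" using S(2) \<sigma>d by (intro prod.cong) auto
    also have "\<dots> = (\<Prod>i\<in>S. d i)" by (rule prod.reindex_bij_betw[OF bij])
    finally show "\<sigma> (\<Prod>i\<in>S. d i) = (\<Prod>i\<in>S. d i)" .
  qed
  then obtain n where n: "(\<Prod>i\<in>S. d i) = of_int n" by (auto elim: Ints_cases)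
  have "(\<Prod>i\<in>S. d i) \<noteq> 0" using S(1) by (auto simp: S_def)
  hence "cmod (\<Prod>i\<in>S. d i) \<ge> 1" using n by simp
  moreover have "cmod (\<Prod>i\<in>S. d i) < (\<Prod>i\<in>S. 1)"
    unfolding prod_norm[symmetric] using S small
    by (intro prod_mono_strict[of j]) (auto simp: less_imp_le)
  ultimately show False by simp
qed

section \<open>Polynomials, heights and counting\<close>

text \<open>The product of all differences is a nonzero polynomial, of degree at most the given bound; one of
  the integers up to its degree is not a root.\<close>
lemma poly_family_separated_by_nat:
  fixes p :: "'j \<Rightarrow> complex poly"
  assumes "finite J" "inj_on p J" "\<And>j. j \<in> J \<Longrightarrow> Polynomial.degree (p j) \<le> d"
  shows "\<exists>t \<le> (card J)\<^sup>2 * d. inj_on (\<lambda>j. poly (p j) (of_nat t)) J"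
proof -
  let ?I = "{(i, j) \<in> J \<times> J. i \<noteq> j}"
  define q where "q = (\<Prod>(i, j)\<in>?I. p i - p j)"
  have fin: "finite ?I" using assms(1) by (auto intro: finite_subset[of _ "J \<times> J"])
  have "q \<noteq> 0" using assms(2) fin by (auto simp: q_def inj_on_def)
  have "card ?I \<le> card (J \<times> J)" using assms(1) by (intro card_mono) auto
  hence cI: "card ?I \<le> (card J)\<^sup>2" by (simp add: card_cartesian_product power2_eq_square)
  have "Polynomial.degree q \<le> (\<Sum>(i, j)\<in>?I. Polynomial.degree (p i - p j))"
    unfolding q_def by (rule order_trans[OF degree_prod_sum_le[OF fin]]) (auto simp: case_prod_unfold)
  also have "\<dots> \<le> (\<Sum>_\<in>?I. d)"
    using assms(3) by (intro sum_mono) (auto intro: degree_diff_le)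
  also have "\<dots> \<le> (card J)\<^sup>2 * d" using cI by simp
  finally have deg: "Polynomial.degree q \<le> (card J)\<^sup>2 * d" .
  have "\<exists>t \<le> (card J)\<^sup>2 * d. poly q (of_nat t) \<noteq> 0"
  proof (rule ccontr)
    assume "\<not> ?thesis"
    hence "of_nat ` {..(card J)\<^sup>2 * d} \<subseteq> {x. poly q x = 0}" by auto
    hence "card (of_nat ` {..(card J)\<^sup>2 * d} :: complex set) \<le> card {x. poly q x = 0}"
      using \<open>q \<noteq> 0\<close> by (intro card_mono poly_roots_finite) auto
    also have "\<dots> \<le> Polynomial.degree q" using card_poly_roots_bound[OF \<open>q \<noteq> 0\<close>] .
    finally show False using deg by (simp add: card_image)
  qed
  then obtain t where "t \<le> (card J)\<^sup>2 * d" "poly q (of_nat t) \<noteq> 0" by blast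
  moreover from this have "poly (p i) (of_nat t) \<noteq> poly (p j) (of_nat t)"
    if "i \<in> J" "j \<in> J" "i \<noteq> j" for i j
    using that fin by (fastforce simp: q_def poly_prod prod_zero_iff)
  ultimately show ?thesis by (auto simp: inj_on_def)
qed

text \<open>Interpolation: the leading coefficients agree, so as many values as the degree suffice.\<close>
lemma monic_prod_eq_if_values_eq:
  fixes \<gamma> \<gamma>' :: "'j \<Rightarrow> complex"
  assumes "finite J"
    and "\<And>w. w < card J \<Longrightarrow> (\<Prod>j\<in>J. of_nat (u + w) - \<gamma> j) = (\<Prod>j\<in>J. of_nat (u + w) - \<gamma>' j)"
  shows "(\<Prod>j\<in>J. [:- \<gamma> j, 1:]) = (\<Prod>j\<in>J. [:- \<gamma>' j, 1:])"
proof (rule poly_eqI_degree_lead_coeff[where n = "card J" and A = "(\<lambda>w. of_nat (u + w)) ` {..<card J}"])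
  have deg: "Polynomial.degree (\<Prod>j\<in>J. [:- \<gamma> j, 1:]) = card J" for \<gamma> :: "'j \<Rightarrow> complex"
    by (subst degree_prod_eq_sum_degree) auto
  have lead: "lead_coeff (\<Prod>j\<in>J. [:- \<gamma> j, 1:]) = 1" for \<gamma> :: "'j \<Rightarrow> complex"
    by (simp add: lead_coeff_prod)
  show "poly.coeff (\<Prod>j\<in>J. [:- \<gamma> j, 1:]) (card J) = poly.coeff (\<Prod>j\<in>J. [:- \<gamma>' j, 1:]) (card J)"
    using lead[of \<gamma>] lead[of \<gamma>'] unfolding deg by simp
  show "Polynomial.degree (\<Prod>j\<in>J. [:- \<gamma> j, 1:]) \<le> card J"
    "Polynomial.degree (\<Prod>j\<in>J. [:- \<gamma>' j, 1:]) \<le> card J" unfolding deg by simp_all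
  show "card J \<le> card ((\<lambda>w. of_nat (u + w) :: complex) ` {..<card J})"
    by (subst card_image) (auto simp: inj_on_def)
  show "poly (\<Prod>j\<in>J. [:- \<gamma> j, 1:]) z = poly (\<Prod>j\<in>J. [:- \<gamma>' j, 1:]) z"
    if "z \<in> (\<lambda>w. of_nat (u + w)) ` {..<card J}" for z
    using that assms(2) by (auto simp: poly_prod algebra_simps)
qed

text \<open>An arbitrary numbering of the roots of \<open>p\<close>. It turns the boundedly many ways to order the
  roots into a component of the code.\<close>
definition root_index :: "complex poly \<Rightarrow> complex \<Rightarrow> nat" where
  "root_index p = (SOME g. bij_betw g {z. poly p z = 0} {0..<card {z. poly p z = 0}})"

lemma root_index:
  assumes "p \<noteq> 0"
  shows "inj_on (root_index p) {z. poly p z = 0}"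
    and "poly p z = 0 \<Longrightarrow> root_index p z < Polynomial.degree p"
proof -
  have bij: "bij_betw (root_index p) {z. poly p z = 0} {0..<card {z. poly p z = 0}}"
    unfolding root_index_def
    using ex_bij_betw_finite_nat[OF poly_roots_finite[OF assms]] by (rule someI_ex)
  show "inj_on (root_index p) {z. poly p z = 0}" using bij by (rule bij_betw_imp_inj_on)
  assume "poly p z = 0"
  hence "root_index p z < card {z. poly p z = 0}" using bij_betwE[OF bij] by simp
  thus "root_index p z < Polynomial.degree p" using card_poly_roots_bound[OF assms] by simp
qed

text \<open>Rankin's trick: each vector in question has weight \<open>(B / (\<Prod>j\<in>J. max 1 \<bar>y j\<bar>)) powr s \<ge> 1\<close>, and the sum of
  the weights over all integer vectors is a product of convergent series. This is the only source of
  \<open>\<epsilon>\<close> in the final bound.\<close>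
lemma card_bounded_height_product:
  fixes s :: real
  assumes "s > 1" "finite J"
  shows "\<exists>C>0. \<forall>B\<ge>1. finite {y \<in> J \<rightarrow>\<^sub>E UNIV. (\<Prod>j\<in>J. max 1 \<bar>real_of_int (y j)\<bar>) \<le> B} \<and>
    real (card {y \<in> J \<rightarrow>\<^sub>E UNIV. (\<Prod>j\<in>J. max 1 \<bar>real_of_int (y j)\<bar>) \<le> B}) \<le> C * B powr s"
proof -
  define w where "w = (\<lambda>x. max 1 \<bar>x :: real\<bar> powr (- s))"
  have w_pos: "w x > 0" for x by (simp add: w_def)
  have "summable (\<lambda>n. real n powr (- s))" using assms(1) by (simp add: summable_real_powr_iff)
  moreover have "\<forall>\<^sub>F n in sequentially. w (real n) = real n powr (- s)"
    using eventually_ge_at_top[of 1] by eventually_elim (simp add: w_def max_def)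
  ultimately have sw: "summable (\<lambda>n. w (real n))" by (simp add: summable_cong)
  define Z where "Z = 2 * (\<Sum>n. w (real n)) + 1"
  have Z0: "Z > 0" using suminf_nonneg[OF sw] w_pos by (simp add: Z_def less_imp_le add_nonneg_pos)
  have sum_le: "(\<Sum>y\<in>{- K..K}. w (real_of_int y)) \<le> Z" for K :: int
  proof -
    have nat_part: "(\<Sum>y\<in>{0..K}. w (real_of_int y)) \<le> (\<Sum>n. w (real n))"
    proof -
      have "(\<Sum>y\<in>{0..K}. w (real_of_int y)) = (\<Sum>n\<in>nat ` {0..K}. w (real n))"
        by (subst sum.reindex) (auto simp: inj_on_def intro!: sum.cong)
      also have "\<dots> \<le> (\<Sum>n. w (real n))"
        by (intro sum_le_suminf sw) (auto simp: w_pos less_imp_le)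
      finally show ?thesis .
    qed
    have "(\<Sum>y\<in>{- K..K}. w (real_of_int y)) \<le> (\<Sum>y\<in>uminus ` {0..K} \<union> {0..K}. w (real_of_int y))"
      by (intro sum_mono2) (auto simp: w_pos less_imp_le)
    also have "\<dots> \<le> (\<Sum>y\<in>uminus ` {0..K}. w (real_of_int y)) + (\<Sum>y\<in>{0..K}. w (real_of_int y))"
      by (subst sum_Un) (auto intro!: sum_nonneg simp: w_pos less_imp_le)
    also have "(\<Sum>y\<in>uminus ` {0..K}. w (real_of_int y)) = (\<Sum>y\<in>{0..K}. w (real_of_int y))"
      by (subst sum.reindex) (auto simp: inj_on_def w_def)
    finally show ?thesis using nat_part by (simp add: Z_def)
  qed
  have "finite {y \<in> J \<rightarrow>\<^sub>E UNIV. (\<Prod>j\<in>J. max 1 \<bar>real_of_int (y j)\<bar>) \<le> B} \<and>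
    real (card {y \<in> J \<rightarrow>\<^sub>E UNIV. (\<Prod>j\<in>J. max 1 \<bar>real_of_int (y j)\<bar>) \<le> B}) \<le> Z ^ card J * B powr s"
    (is "finite ?Y \<and> _") if "B \<ge> 1" for B
  proof -
    let ?P = "J \<rightarrow>\<^sub>E {- \<lfloor>B\<rfloor>..\<lfloor>B\<rfloor>}"
    have fin: "finite ?P" using assms(2) by (intro finite_PiE) auto
    have sub: "?Y \<subseteq> ?P"
    proof
      fix y assume y: "y \<in> ?Y"
      have "\<bar>y j\<bar> \<le> \<lfloor>B\<rfloor>" if "j \<in> J" for j
      proof -
        have "max 1 \<bar>real_of_int (y j)\<bar> * 1 \<le> max 1 \<bar>real_of_int (y j)\<bar> * (\<Prod>j\<in>J - {j}. max 1 \<bar>real_of_int (y j)\<bar>)"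
          by (intro mult_left_mono prod_ge_1) auto
        also have "\<dots> = (\<Prod>j\<in>J. max 1 \<bar>real_of_int (y j)\<bar>)"
          by (rule prod.remove[symmetric, OF assms(2) that])
        also have "\<dots> \<le> B" using y by simp
        finally show ?thesis by (simp add: le_floor_iff)
      qed
      thus "y \<in> ?P" using y by (auto simp: PiE_iff abs_le_iff minus_le_iff)
    qed
    have "real (card ?Y) = (\<Sum>y\<in>?Y. 1)" by simp
    also have "\<dots> \<le> (\<Sum>y\<in>?Y. B powr s * (\<Prod>j\<in>J. w (real_of_int (y j))))"
    proof (rule sum_mono)
      fix y assume y: "y \<in> ?Y"
      define h where "h = (\<Prod>j\<in>J. max 1 \<bar>real_of_int (y j)\<bar>)"
      have h: "1 \<le> h" "h \<le> B" using y by (auto simp: h_def intro!: prod_ge_1)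
      have "(\<Prod>j\<in>J. w (real_of_int (y j))) = h powr (- s)"
        unfolding w_def h_def by (rule prod_powr_distrib[symmetric])
      moreover have "h powr s \<le> B powr s" using h assms(1) by (simp add: powr_mono2)
      moreover have "h powr s * h powr (- s) = 1" using h by (simp flip: powr_add)
      ultimately show "1 \<le> B powr s * (\<Prod>j\<in>J. w (real_of_int (y j)))"
        using mult_right_mono[of "h powr s" "B powr s" "h powr (- s)"] by simp
    qed
    also have "\<dots> = B powr s * (\<Sum>y\<in>?Y. \<Prod>j\<in>J. w (real_of_int (y j)))"
      by (rule sum_distrib_left[symmetric])
    also have "\<dots> \<le> B powr s * Z ^ card J"
    proof (rule mult_left_mono)
      have "(\<Sum>y\<in>?Y. \<Prod>j\<in>J. w (real_of_int (y j))) \<le> (\<Sum>y\<in>?P. \<Prod>j\<in>J. w (real_of_int (y j)))"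
        by (intro sum_mono2 fin sub prod_nonneg) (auto simp: w_pos less_imp_le)
      also have "\<dots> = (\<Prod>j\<in>J. \<Sum>y\<in>{- \<lfloor>B\<rfloor>..\<lfloor>B\<rfloor>}. w (real_of_int y))"
        by (rule prod_sum_PiE[symmetric]) (auto simp: assms(2))
      also have "\<dots> \<le> (\<Prod>j\<in>J. Z)"
        by (intro prod_mono) (auto intro!: sum_nonneg sum_le simp: w_pos less_imp_le)
      finally show "(\<Sum>y\<in>?Y. \<Prod>j\<in>J. w (real_of_int (y j))) \<le> Z ^ card J" by simp
    qed simp
    finally show ?thesis using finite_subset[OF sub fin] by (simp add: mult.commute)
  qed
  thus ?thesis using Z0 by (intro exI[of _ "Z ^ card J"]) auto
qed

lemma abs_coeff_le_height: "\<bar>poly.coeff f i\<bar> \<le> Defs.height f"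
proof (cases "i \<le> Polynomial.degree f")
  case True
  thus ?thesis unfolding Defs.height_def by (intro Max_ge) auto
next
  case False
  have "\<bar>poly.coeff f 0\<bar> \<le> Defs.height f" unfolding Defs.height_def by (intro Max_ge) auto
  thus ?thesis using False by (simp add: coeff_eq_0)
qed

lemma complex_poly_eq_prod_roots:
  assumes "f \<in> monic_polys n H" "Defs.separable f"
  shows "map_poly of_int f = (\<Prod>z\<in>root_set f. [:- z, 1:])"
proof -
  have "lead_coeff (map_poly of_int f :: complex poly) = 1"
    using assms(1) by (auto simp: monic_polys_def)
  thus ?thesis
    using complex_poly_decompose_rsquarefree[OF assms(2)[unfolded Defs.separable_def]]
    unfolding root_set_def by simp
qed

lemma mahler_measure_separable_le:
  assumes f: "f \<in> monic_polys n H" "Defs.separable f" and "H \<ge> 1"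
  shows "(\<Prod>z\<in>root_set f. max 1 (cmod z)) \<le> sqrt (real n + 1) * H"
proof -
  have f0: "f \<noteq> 0" using f by (auto simp: monic_polys_def)
  let ?p = "map_poly of_int f :: complex poly"
  have "finite (root_set f)" unfolding root_set_def using f0 by (intro poly_roots_finite) simp
  then obtain zs where zs: "set zs = root_set f" "distinct zs" using finite_distinct_list by blast
  have p: "?p = smult 1 (\<Prod>z\<leftarrow>zs. [:- z, 1:])"
    using complex_poly_eq_prod_roots[OF f] zs by (simp flip: prod.distinct_set_conv_list)
  have "(\<Prod>z\<in>root_set f. max 1 (cmod z)) = mahler_measure_poly ?p"
    using zs unfolding p mahler_measure_poly_explicit by (simp flip: prod.distinct_set_conv_list)
  also have "\<dots> \<le> sqrt (\<Sum>a\<leftarrow>coeffs ?p. (cmod a)\<^sup>2)" by (rule Landau_inequality)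
  also have "(\<Sum>a\<leftarrow>coeffs ?p. (cmod a)\<^sup>2) \<le> (real n + 1) * H\<^sup>2"
  proof -
    have le: "cmod a \<le> H" if a: "a \<in> set (coeffs ?p)" for a
    proof -
      obtain c where c: "c \<in> set (coeffs f)" "a = of_int c" using a by auto
      hence "c \<in> range (poly.coeff f)" by (simp add: range_coeff)
      then obtain i where "c = poly.coeff f i" by auto
      hence "cmod a = real_of_int \<bar>poly.coeff f i\<bar>" using c(2) by simp
      also have "\<dots> \<le> real_of_int (Defs.height f)" using abs_coeff_le_height by (simp only: of_int_le_iff)
      also have "\<dots> \<le> H" using f by (simp add: monic_polys_def)
      finally show ?thesis .
    qed
    have "(\<Sum>a\<leftarrow>coeffs ?p. (cmod a)\<^sup>2) \<le> (\<Sum>a\<leftarrow>coeffs ?p. H\<^sup>2)"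
      using le by (intro sum_list_mono power_mono) auto
    also have "\<dots> = (real n + 1) * H\<^sup>2"
    proof -
      have "Polynomial.degree ?p = n" "?p \<noteq> 0" using f f0 by (auto simp: monic_polys_def)
      hence "length (coeffs ?p) = Suc n" using length_coeffs_degree[of ?p] by simp
      thus ?thesis unfolding sum_list_triv by simp
    qed
    finally show ?thesis .
  qed
  finally show ?thesis using \<open>H \<ge> 1\<close> by (simp add: real_sqrt_mult)
qed

section \<open>Invariants of a labelling of the roots by the product action\<close>

abbreviation subsets_of_card :: "nat \<Rightarrow> nat \<Rightarrow> nat set set" where
  "subsets_of_card m k \<equiv> {a. a \<subseteq> {1..m} \<and> card a = k}"

lemma finite_subsets_of_card: "finite (subsets_of_card m k)"
  by (rule finite_subset[of _ "Pow {1..m}"]) auto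

lemma card_subsets_of_card: "card (subsets_of_card m k) = m choose k"
  using n_subsets[of "{1..m}" k] by simp

lemma finite_primitive_domain: "finite (primitive_domain m r k)"
  unfolding primitive_domain_def by (intro finite_PiE finite_subsets_of_card) auto

lemma card_primitive_domain: "card (primitive_domain m r k) = (m choose k) ^ r"
  unfolding primitive_domain_def card_PiE[OF finite_atLeastAtMost] card_subsets_of_card prod_constant
  by simp

lemma primitive_action_at:
  assumes "(\<tau>, \<rho>) \<in> carrier (sym_wreath m r)" "A \<in> primitive_domain m r k" "i \<in> {1..r}"
  shows "\<rho> i \<in> {1..r}" and "primitive_action m r k (\<tau>, \<rho>) A (\<rho> i) = \<tau> (\<rho> i) ` A i"
proof -
  have \<rho>: "\<rho> permutes {1..r}" using assms(1) by (simp add: sym_wreath_carrier)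
  show "\<rho> i \<in> {1..r}" using permutes_in_image[OF \<rho>] assms(3) by blast
  thus "primitive_action m r k (\<tau>, \<rho>) A (\<rho> i) = \<tau> (\<rho> i) ` A i"
    using assms(2) permutes_inverses(2)[OF \<rho>] by (simp add: primitive_action_def)
qed

lemma bij_betw_primitive_action:
  assumes "g \<in> carrier (sym_wreath m r)"
  shows "bij_betw (primitive_action m r k g) (primitive_domain m r k) (primitive_domain m r k)"
  using group_action.bij_prop0[OF group_action_primitive assms] by (simp add: Bij_def)

lemma image_subsets_of_card:
  assumes "(\<tau>, \<rho>) \<in> carrier (sym_wreath m r)" "i \<in> {1..r}"
  shows "bij_betw ((`) (\<tau> i)) (subsets_of_card m k) (subsets_of_card m k)"
proof -
  have \<tau>: "\<tau> i permutes {1..m}" using assms by (simp add: sym_wreath_carrier)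
  have "inj_on ((`) (\<tau> i)) (subsets_of_card m k)"
    using permutes_inj[OF \<tau>] by (auto simp: inj_on_def inj_image_eq_iff)
  moreover have "(`) (\<tau> i) ` subsets_of_card m k \<subseteq> subsets_of_card m k"
    using permutes_image[OF \<tau>] permutes_inj[OF \<tau>]
    by (auto simp: card_image inj_on_subset)
  ultimately show ?thesis
    using endo_inj_surj[OF finite_subsets_of_card] by (auto simp: bij_betw_def)
qed

text \<open>Complex numbers labelled by the set on which the wreath product acts. All that is kept of
  the polynomial is that the numbers are algebraic integers and that embeddings act through the wreath
  product.\<close>
locale wreath_labelling =
  fixes m r k :: nat and \<alpha> :: "(nat \<Rightarrow> nat set) \<Rightarrow> complex"
  assumes \<alpha>_algebraic_int: "A \<in> primitive_domain m r k \<Longrightarrow> algebraic_int (\<alpha> A)"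
    and \<alpha>_permuted: "algebraic_embedding D \<sigma> \<Longrightarrow>
      \<exists>\<tau> \<rho>. (\<tau>, \<rho>) \<in> carrier (sym_wreath m r) \<and>
        (\<forall>A\<in>primitive_domain m r k. \<sigma> (\<alpha> A) = \<alpha> (primitive_action m r k (\<tau>, \<rho>) A))"
begin

text \<open>The value at \<open>t\<close> of the factor of the polynomial that belongs to the labels with
  \<open>i\<close>-th coordinate \<open>a\<close>.\<close>
definition fibre_value :: "nat \<Rightarrow> nat \<Rightarrow> nat set \<Rightarrow> complex" where
  "fibre_value t i a = (\<Prod>A\<in>{A \<in> primitive_domain m r k. A i = a}. of_nat t - \<alpha> A)"

text \<open>The value at \<open>u + w\<close> of the polynomial whose roots are the fibre values for the coordinate \<open>i\<close>.\<close>
definition block_value :: "nat \<Rightarrow> nat \<Rightarrow> nat \<Rightarrow> nat \<Rightarrow> complex" where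
  "block_value t u w i = (\<Prod>a\<in>subsets_of_card m k. of_nat (u + w) - fibre_value t i a)"

lemma fibre_value_algebraic_int: "algebraic_int (fibre_value t i a)"
  unfolding fibre_value_def by (intro algebraic_int_prod algebraic_int_diff) (auto simp: \<alpha>_algebraic_int)

lemma block_value_algebraic_int: "algebraic_int (block_value t u w i)"
  unfolding block_value_def by (intro algebraic_int_prod algebraic_int_diff) (auto simp: fibre_value_algebraic_int simp del: of_nat_add)

text \<open>An element of the wreath product maps the labels with \<open>i\<close>-th coordinate \<open>a\<close> to the labels with
  prescribed coordinate in position \<open>\<rho> i\<close>. So embeddings permute the fibre values, in blocks
  indexed by the coordinates.\<close>
lemma hom_fibre_value:
  assumes emb: "algebraic_embedding D \<sigma>" and g: "(\<tau>, \<rho>) \<in> carrier (sym_wreath m r)"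
    and \<sigma>\<alpha>: "\<And>A. A \<in> primitive_domain m r k \<Longrightarrow> \<sigma> (\<alpha> A) = \<alpha> (primitive_action m r k (\<tau>, \<rho>) A)"
    and i: "i \<in> {1..r}"
  shows "\<sigma> (fibre_value t i a) = fibre_value t (\<rho> i) (\<tau> (\<rho> i) ` a)"
proof -
  interpret algebraic_embedding D \<sigma> by (rule emb)
  let ?\<Omega> = "primitive_domain m r k" and ?g = "primitive_action m r k (\<tau>, \<rho>)"
  have inD: "\<alpha> A \<in> D" if "A \<in> ?\<Omega>" for A using \<alpha>_algebraic_int[OF that] by (rule algebraic_int_in)
  have "inj (\<tau> (\<rho> i))"
    using g primitive_action_at(1)[OF g _ i] i permutes_inj permutes_in_image
    by (metis sym_wreath_carrier)
  hence at: "?g A (\<rho> i) = \<tau> (\<rho> i) ` a \<longleftrightarrow> A i = a" if "A \<in> ?\<Omega>" for A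
    using primitive_action_at(2)[OF g that i] by (simp add: inj_image_eq_iff)
  have bij: "bij_betw ?g {A \<in> ?\<Omega>. A i = a} {A \<in> ?\<Omega>. A (\<rho> i) = \<tau> (\<rho> i) ` a}"
  proof -
    note g_bij = bij_betw_primitive_action[OF g, of k]
    have "?g ` {A \<in> ?\<Omega>. A i = a} = {A \<in> ?\<Omega>. A (\<rho> i) = \<tau> (\<rho> i) ` a}"
    proof (intro equalityI subsetI)
      fix A assume "A \<in> ?g ` {A \<in> ?\<Omega>. A i = a}"
      thus "A \<in> {A \<in> ?\<Omega>. A (\<rho> i) = \<tau> (\<rho> i) ` a}" using at bij_betwE[OF g_bij] by auto
    next
      fix A assume A: "A \<in> {A \<in> ?\<Omega>. A (\<rho> i) = \<tau> (\<rho> i) ` a}"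
      hence "A \<in> ?g ` ?\<Omega>" using bij_betw_imp_surj_on[OF g_bij] by simp
      then obtain A' where A': "A' \<in> ?\<Omega>" "A = ?g A'" by blast
      hence "A' i = a" using A at by simp
      thus "A \<in> ?g ` {A \<in> ?\<Omega>. A i = a}" using A' by blast
    qed
    moreover have "inj_on ?g {A \<in> ?\<Omega>. A i = a}"
      by (rule inj_on_subset[OF bij_betw_imp_inj_on[OF g_bij]]) auto
    ultimately show ?thesis by (simp add: bij_betw_def)
  qed
  have "\<sigma> (fibre_value t i a) = (\<Prod>A\<in>{A \<in> ?\<Omega>. A i = a}. \<sigma> (of_nat t - \<alpha> A))"
    unfolding fibre_value_def using inD by (intro hom_prod of_nat_diff_in) auto
  also have "\<dots> = (\<Prod>A\<in>{A \<in> ?\<Omega>. A i = a}. of_nat t - \<alpha> (?g A))"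
    using inD \<sigma>\<alpha> by (intro prod.cong refl) (simp add: hom_of_nat_diff)
  also have "\<dots> = (\<Prod>A\<in>{A \<in> ?\<Omega>. A (\<rho> i) = \<tau> (\<rho> i) ` a}. of_nat t - \<alpha> A)"
    by (rule prod.reindex_bij_betw[OF bij])
  finally show ?thesis by (simp add: fibre_value_def)
qed

lemma hom_block_value:
  assumes emb: "algebraic_embedding D \<sigma>" and g: "(\<tau>, \<rho>) \<in> carrier (sym_wreath m r)"
    and \<sigma>\<alpha>: "\<And>A. A \<in> primitive_domain m r k \<Longrightarrow> \<sigma> (\<alpha> A) = \<alpha> (primitive_action m r k (\<tau>, \<rho>) A)"
    and i: "i \<in> {1..r}"
  shows "\<sigma> (block_value t u w i) = block_value t u w (\<rho> i)"
proof -
  interpret algebraic_embedding D \<sigma> by (rule emb)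
  have \<rho>i: "\<rho> i \<in> {1..r}" using g i permutes_in_image by (metis sym_wreath_carrier)
  have inD: "fibre_value t i a \<in> D" for a by (intro algebraic_int_in fibre_value_algebraic_int)
  have "\<sigma> (block_value t u w i) = (\<Prod>a\<in>subsets_of_card m k. \<sigma> (of_nat (u + w) - fibre_value t i a))"
    unfolding block_value_def using inD by (intro hom_prod of_nat_diff_in)
  also have "\<dots> = (\<Prod>a\<in>subsets_of_card m k. of_nat (u + w) - fibre_value t (\<rho> i) (\<tau> (\<rho> i) ` a))"
    using inD hom_fibre_value[OF emb g \<sigma>\<alpha> i] by (intro prod.cong refl) (simp only: hom_of_nat_diff)
  also have "\<dots> = block_value t u w (\<rho> i)"
    unfolding block_value_def by (rule prod.reindex_bij_betw[OF image_subsets_of_card[OF g \<rho>i]])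
  finally show ?thesis .
qed

lemma norm_prod_values_in_Ints: "(\<Prod>i\<in>{1..r}. of_nat w' - block_value t u w i) \<in> \<int>"
proof (rule integer_if_fixed_by_embeddings)
  show "algebraic_int (\<Prod>i\<in>{1..r}. of_nat w' - block_value t u w i)"
    by (intro algebraic_int_prod algebraic_int_diff block_value_algebraic_int) auto
  fix D \<sigma> assume emb: "algebraic_embedding D \<sigma>"
  interpret algebraic_embedding D \<sigma> by (rule emb)
  obtain \<tau> \<rho> where g: "(\<tau>, \<rho>) \<in> carrier (sym_wreath m r)"
    "\<And>A. A \<in> primitive_domain m r k \<Longrightarrow> \<sigma> (\<alpha> A) = \<alpha> (primitive_action m r k (\<tau>, \<rho>) A)"
    using \<alpha>_permuted[OF emb] by blast
  have inD: "block_value t u w i \<in> D" for i by (intro algebraic_int_in block_value_algebraic_int)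
  have "\<sigma> (\<Prod>i\<in>{1..r}. of_nat w' - block_value t u w i) = (\<Prod>i\<in>{1..r}. \<sigma> (of_nat w' - block_value t u w i))"
    using inD by (intro hom_prod of_nat_diff_in) auto
  also have "\<dots> = (\<Prod>i\<in>{1..r}. of_nat w' - block_value t u w (\<rho> i))"
    using inD hom_block_value[OF emb g] by (intro prod.cong refl) (simp only: hom_of_nat_diff)
  also have "\<dots> = (\<Prod>i\<in>{1..r}. of_nat w' - block_value t u w i)"
    by (rule prod.reindex_bij_betw[OF permutes_imp_bij]) (use g(1) in \<open>simp add: sym_wreath_carrier\<close>)
  finally show "\<sigma> (\<Prod>i\<in>{1..r}. of_nat w' - block_value t u w i) = (\<Prod>i\<in>{1..r}. of_nat w' - block_value t u w i)" .
qed

end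

lemma poly_linear_prod:
  "poly (\<Prod>j\<in>J. [:- f j, 1:]) z = (\<Prod>j\<in>J. z - f j :: complex)"
  by (simp add: poly_prod)

lemma roots_linear_prod:
  "finite J \<Longrightarrow> {z. poly (\<Prod>j\<in>J. [:- f j :: complex, 1:]) z = 0} = f ` J"
  unfolding poly_linear_prod by auto

lemma degree_linear_prod:
  "finite J \<Longrightarrow> Polynomial.degree (\<Prod>j\<in>J. [:- f j :: complex, 1:]) = card J"
  by (subst degree_prod_eq_sum_degree) auto

text \<open>Fixing a coordinate to \<open>a\<close> leaves another coordinate free to differ from \<open>b\<close>, since there are at least
  two subsets.\<close>
lemma coordinate_fibre_eq_iff:
  assumes "m choose k \<ge> 2" and i: "i \<in> {1..r}" "j \<in> {1..r}"
    and a: "a \<in> subsets_of_card m k" "b \<in> subsets_of_card m k"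
    and eq: "{A \<in> primitive_domain m r k. A i = a} = {A \<in> primitive_domain m r k. A j = b}"
  shows "i = j \<and> a = b"
proof -
  have "\<not> subsets_of_card m k \<subseteq> {b}"
  proof
    assume "subsets_of_card m k \<subseteq> {b}"
    hence "card (subsets_of_card m k) \<le> card {b}" by (intro card_mono) auto
    thus False using assms(1) unfolding card_subsets_of_card by simp
  qed
  then obtain c where c: "c \<in> subsets_of_card m k" "c \<noteq> b" by blast
  define A where "A = (\<lambda>l\<in>{1..r}. if l = i then a else c)"
  have "A \<in> primitive_domain m r k"
    unfolding primitive_domain_def A_def using a c by (auto split: if_splits)
  moreover have "A i = a" using i by (simp add: A_def)
  ultimately have "A j = b" using eq by blast
  thus ?thesis using i c by (auto simp: A_def split: if_splits)
qed

lemma norm_of_nat_diff_le: "cmod (of_nat t - x) \<le> (real t + 1) * max 1 (cmod x)"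
proof -
  have "cmod (of_nat t - x) \<le> real t * 1 + cmod x"
    using norm_triangle_ineq4[of "of_nat t :: complex" x] by simp
  also have "\<dots> \<le> real t * max 1 (cmod x) + max 1 (cmod x)"
    by (intro add_mono mult_left_mono) auto
  finally show ?thesis by (simp add: algebra_simps)
qed

context wreath_labelling
begin

lemma fibre_value_separated:
  assumes "inj_on \<alpha> (primitive_domain m r k)" "m choose k \<ge> 2"
  shows "\<exists>t \<le> (r * (m choose k))\<^sup>2 * (m choose k) ^ r.
    inj_on (\<lambda>(i, a). fibre_value t i a) ({1..r} \<times> subsets_of_card m k)"
proof -
  let ?\<Omega> = "primitive_domain m r k" and ?J = "{1..r} \<times> subsets_of_card m k"
  define p where "p = (\<lambda>(i, a). \<Prod>A\<in>{A \<in> ?\<Omega>. A i = a}. [:- \<alpha> A, 1:])"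
  have fin: "finite {A \<in> ?\<Omega>. A i = a}" for i a using finite_primitive_domain by simp
  have "inj_on p ?J"
  proof (rule inj_onI, clarify)
    fix i a j b assume *: "i \<in> {1..r}" "j \<in> {1..r}" "a \<subseteq> {1..m}" "k = card a" "b \<subseteq> {1..m}"
      "card b = card a" "p (i, a) = p (j, b)"
    have roots: "{z. poly (p (i, a)) z = 0} = \<alpha> ` {A \<in> ?\<Omega>. A i = a}" for i a
      using roots_linear_prod[OF fin] by (simp only: p_def case_prod_conv)
    have "\<alpha> ` {A \<in> ?\<Omega>. A i = a} = \<alpha> ` {A \<in> ?\<Omega>. A j = b}"
      using roots[of i a] roots[of j b] *(7) by simp
    hence "{A \<in> ?\<Omega>. A i = a} = {A \<in> ?\<Omega>. A j = b}"
      by (subst (asm) inj_on_image_eq_iff[OF assms(1)]) auto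
    thus "i = j \<and> a = b" using coordinate_fibre_eq_iff[OF assms(2)] * by blast
  qed
  moreover have "Polynomial.degree (p j) \<le> (m choose k) ^ r" if "j \<in> ?J" for j
    using card_mono[OF finite_primitive_domain, of "{A \<in> ?\<Omega>. A (fst j) = snd j}" m r k] fin
    unfolding p_def case_prod_unfold degree_linear_prod[OF fin] card_primitive_domain by auto
  moreover have "finite ?J" using finite_subsets_of_card by simp
  ultimately obtain t where t: "t \<le> (card ?J)\<^sup>2 * (m choose k) ^ r" "inj_on (\<lambda>j. poly (p j) (of_nat t)) ?J"
    using poly_family_separated_by_nat[of ?J p "(m choose k) ^ r"] by blast
  have "(\<lambda>j. poly (p j) (of_nat t)) = (\<lambda>(i, a). fibre_value t i a)"
    unfolding p_def case_prod_unfold poly_linear_prod fibre_value_def ..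
  moreover have "card ?J = r * (m choose k)"
    unfolding card_cartesian_product card_subsets_of_card by simp
  ultimately show ?thesis using t by auto
qed

definition fibre_poly :: "nat \<Rightarrow> nat \<Rightarrow> complex poly" where
  "fibre_poly t i = (\<Prod>a\<in>subsets_of_card m k. [:- fibre_value t i a, 1:])"

definition block_poly :: "nat \<Rightarrow> nat \<Rightarrow> complex poly" where
  "block_poly t u = (\<Prod>i\<in>{1..r}. [:- block_value t u 0 i, 1:])"

lemma block_value_separated:
  assumes "inj_on (\<lambda>(i, a). fibre_value t i a) ({1..r} \<times> subsets_of_card m k)" "m choose k \<ge> 2"
  shows "\<exists>u \<le> r\<^sup>2 * (m choose k). inj_on (block_value t u 0) {1..r}"
proof -
  have "inj_on (fibre_poly t) {1..r}"
  proof (rule inj_onI)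
    fix i j assume ij: "i \<in> {1..r}" "j \<in> {1..r}" "fibre_poly t i = fibre_poly t j"
    have roots: "{z. poly (fibre_poly t i) z = 0} = fibre_value t i ` subsets_of_card m k" for i
      unfolding fibre_poly_def by (rule roots_linear_prod[OF finite_subsets_of_card])
    have "subsets_of_card m k \<noteq> {}" using assms(2) card_subsets_of_card[of m k] by (metis card.empty not_numeral_le_zero)
    then obtain a where a: "a \<in> subsets_of_card m k" by blast
    have "fibre_value t i ` subsets_of_card m k = fibre_value t j ` subsets_of_card m k"
      using roots[of i] roots[of j] ij(3) by simp
    hence "fibre_value t i a \<in> fibre_value t j ` subsets_of_card m k" using imageI[OF a, of "fibre_value t i"] by simp
    then obtain b where "b \<in> subsets_of_card m k" "fibre_value t i a = fibre_value t j b" by blast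
    thus "i = j" using inj_onD[OF assms(1), of "(i, a)" "(j, b)"] ij a by simp
  qed
  moreover have "Polynomial.degree (fibre_poly t i) \<le> m choose k" for i
    unfolding fibre_poly_def degree_linear_prod[OF finite_subsets_of_card] card_subsets_of_card by simp
  ultimately obtain u where "u \<le> (card {1..r})\<^sup>2 * (m choose k)"
    "inj_on (\<lambda>i. poly (fibre_poly t i) (of_nat u)) {1..r}"
    using poly_family_separated_by_nat[of "{1..r}" "fibre_poly t" "m choose k"] by auto
  moreover have "poly (fibre_poly t i) (of_nat u) = block_value t u 0 i" for i
    unfolding fibre_poly_def block_value_def poly_linear_prod by simp
  ultimately show ?thesis by auto
qed

text \<open>Each label occurs in exactly one factor of the product over \<open>a\<close>. This is why a block value is bounded
  by the first power of the Mahler measure, although it is a product over all \<open>\<alpha> A\<close>.\<close>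
lemma norm_block_value_le:
  assumes "i \<in> {1..r}"
  shows "cmod (block_value t u w i) \<le> (real (u + w) + 1) ^ (m choose k) * (real t + 1) ^ ((m choose k) ^ r)
    * (\<Prod>A\<in>primitive_domain m r k. max 1 (cmod (\<alpha> A)))"
proof -
  let ?\<Omega> = "primitive_domain m r k" and ?S = "subsets_of_card m k"
  let ?h = "\<lambda>A. (real t + 1) * max 1 (cmod (\<alpha> A))"
  define M where "M = (\<lambda>a. \<Prod>A\<in>{A \<in> ?\<Omega>. A i = a}. ?h A)"
  have h1: "?h A \<ge> 1" for A
    using mult_mono[of 1 "real t + 1" 1 "max 1 (cmod (\<alpha> A))"] by simp
  have M1: "M a \<ge> 1" for a unfolding M_def using h1 by (intro prod_ge_1)
  have "cmod (fibre_value t i a) \<le> M a" for a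
    unfolding fibre_value_def M_def prod_norm[symmetric] by (intro prod_mono) (auto simp: norm_of_nat_diff_le)
  hence "max 1 (cmod (fibre_value t i a)) \<le> M a" for a using M1 by simp
  hence fac: "cmod (of_nat (u + w) - fibre_value t i a) \<le> (real (u + w) + 1) * M a" for a
    using order_trans[OF norm_of_nat_diff_le[of "u + w" "fibre_value t i a"] mult_left_mono, of "M a"] by simp
  have "cmod (block_value t u w i) \<le> (\<Prod>a\<in>?S. (real (u + w) + 1) * M a)"
    unfolding block_value_def prod_norm[symmetric] using fac by (intro prod_mono) auto
  also have "\<dots> = (real (u + w) + 1) ^ (m choose k) * (\<Prod>a\<in>?S. M a)"
    unfolding prod.distrib prod_constant card_subsets_of_card ..
  also have "(\<Prod>a\<in>?S. M a) = (\<Prod>A\<in>?\<Omega>. ?h A)"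
    unfolding M_def
    by (rule prod.group) (use assms finite_primitive_domain finite_subsets_of_card in \<open>auto simp: primitive_domain_def PiE_iff\<close>)
  also have "\<dots> = (real t + 1) ^ ((m choose k) ^ r) * (\<Prod>A\<in>?\<Omega>. max 1 (cmod (\<alpha> A)))"
    unfolding prod.distrib prod_constant card_primitive_domain ..
  finally show ?thesis by (simp add: mult.assoc)
qed

section \<open>Encoding polynomials by bounded integers\<close>

text \<open>Besides the two separating parameters, the code holds, in this order: the values of the
  polynomial with roots \<open>block_value t u 0 i\<close>; the numbering of these roots; approximations of the
  other block values; the numbering of the fibre values; approximations of the labelled numbers. The
  numberings take boundedly many values, and only the approximations and the first values depend on the
  height.\<close>
definition labelling_code where
  "labelling_code t u = (t, u,
     \<lambda>w\<in>{..<r}. \<lfloor>Re (\<Prod>i\<in>{1..r}. of_nat w - block_value t u 0 i)\<rfloor>,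
     \<lambda>i\<in>{1..r}. root_index (block_poly t u) (block_value t u 0 i),
     \<lambda>(w, i)\<in>{1..<m choose k} \<times> {1..r}. bucket (block_value t u w i),
     \<lambda>(i, a)\<in>{1..r} \<times> subsets_of_card m k. root_index (fibre_poly t i) (fibre_value t i a),
     \<lambda>A\<in>primitive_domain m r k. bucket (\<alpha> A))"

end

lemma restrict_eqD: "restrict f J = restrict g J \<Longrightarrow> j \<in> J \<Longrightarrow> f j = g j"
  by (metis restrict_apply')

lemma roots_eq_if_root_index_eq:
  assumes "finite J" "j \<in> J" "p = (\<Prod>j\<in>J. [:- f j, 1:])" "p = (\<Prod>j\<in>J. [:- g j, 1:])"
    "root_index p (f j) = root_index p (g j)"
  shows "f j = (g j :: complex)"
proof -
  have "p \<noteq> 0" unfolding assms(3) using assms(1) by auto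
  moreover have "poly p (f j) = 0" unfolding assms(3) poly_linear_prod using assms(1,2) by auto
  moreover have "poly p (g j) = 0" unfolding assms(4) poly_linear_prod using assms(1,2) by auto
  ultimately show ?thesis using inj_onD[OF root_index(1) assms(5)] by simp
qed

text \<open>The code is read from left to right. Each level yields numbers that are distinct and therefore show how
  embeddings permute the next level: the block values at \<open>u\<close> determine \<open>\<rho>\<close>, and the fibre values
  determine \<open>\<rho>\<close> and the action of \<open>\<tau>\<close> on subsets, hence the action on labels.\<close>
lemma labelling_eq_if_labelling_code_eq:
  assumes lab: "wreath_labelling m r k \<alpha>" "wreath_labelling m r k \<alpha>'"
    and code: "wreath_labelling.labelling_code m r k \<alpha> t u = wreath_labelling.labelling_code m r k \<alpha>' t' u'"
    and fibre_value_inj: "inj_on (\<lambda>(i, a). wreath_labelling.fibre_value m r k \<alpha> t i a) ({1..r} \<times> subsets_of_card m k)"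
    and v_inj: "inj_on (wreath_labelling.block_value m r k \<alpha> t u 0) {1..r}"
    and A: "A \<in> primitive_domain m r k"
  shows "\<alpha> A = \<alpha>' A"
proof -
  interpret L: wreath_labelling m r k \<alpha> by (rule lab(1))
  interpret L': wreath_labelling m r k \<alpha>' by (rule lab(2))
  have tu: "t' = t" "u' = u" using code by (simp_all add: L.labelling_code_def L'.labelling_code_def)
  note code' = code[unfolded tu L.labelling_code_def L'.labelling_code_def prod.inject]
  have block_values: "(\<Prod>i\<in>{1..r}. of_nat (0 + w) - L.block_value t u 0 i) = (\<Prod>i\<in>{1..r}. of_nat (0 + w) - L'.block_value t u 0 i)"
    if "w < card {1..r}" for w
  proof -
    have "\<lfloor>Re (\<Prod>i\<in>{1..r}. of_nat w - L.block_value t u 0 i)\<rfloor> = \<lfloor>Re (\<Prod>i\<in>{1..r}. of_nat w - L'.block_value t u 0 i)\<rfloor>"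
      using code' that by (auto dest!: restrict_eqD[where j = w])
    moreover have "z = of_int \<lfloor>Re z\<rfloor>" if "z \<in> \<int>" for z using that by (auto elim!: Ints_cases)
    ultimately show ?thesis using L.norm_prod_values_in_Ints L'.norm_prod_values_in_Ints by (metis add_0)
  qed
  have block: "L.block_poly t u = L'.block_poly t u"
    unfolding L.block_poly_def L'.block_poly_def
    by (rule monic_prod_eq_if_values_eq[OF finite_atLeastAtMost block_values])
  have v0: "L.block_value t u 0 i = L'.block_value t u 0 i" if "i \<in> {1..r}" for i
  proof (rule roots_eq_if_root_index_eq[OF finite_atLeastAtMost that L.block_poly_def])
    show "L.block_poly t u = (\<Prod>i\<in>{1..r}. [:- L'.block_value t u 0 i, 1:])" by (simp add: block L'.block_poly_def)
    show "root_index (L.block_poly t u) (L.block_value t u 0 i) = root_index (L.block_poly t u) (L'.block_value t u 0 i)"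
      using code' that block by (auto dest!: restrict_eqD[where j = i])
  qed
  have same_block: "\<rho> i = \<rho>' i"
    if emb: "algebraic_embedding D \<sigma>" and g: "(\<tau>, \<rho>) \<in> carrier (sym_wreath m r)"
      "\<And>A. A \<in> primitive_domain m r k \<Longrightarrow> \<sigma> (\<alpha> A) = \<alpha> (primitive_action m r k (\<tau>, \<rho>) A)"
    and g': "(\<tau>', \<rho>') \<in> carrier (sym_wreath m r)"
      "\<And>A. A \<in> primitive_domain m r k \<Longrightarrow> \<sigma> (\<alpha>' A) = \<alpha>' (primitive_action m r k (\<tau>', \<rho>') A)"
    and i: "i \<in> {1..r}" for D \<sigma> \<tau> \<rho> \<tau>' \<rho>' i
  proof -
    have \<rho>i: "\<rho> i \<in> {1..r}" "\<rho>' i \<in> {1..r}"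
      using g(1) g'(1) i permutes_in_image by (metis sym_wreath_carrier)+
    have "L.block_value t u 0 (\<rho> i) = L.block_value t u 0 (\<rho>' i)"
      using L.hom_block_value[OF emb g i, of t u 0] L'.hom_block_value[OF emb g' i, of t u 0] v0[OF i] v0[OF \<rho>i(2)] by simp
    thus ?thesis using inj_onD[OF v_inj] \<rho>i by blast
  qed
  have v_eq: "L.block_value t u (fst j) (snd j) = L'.block_value t u (fst j) (snd j)" if "j \<in> {..<m choose k} \<times> {1..r}" for j
  proof (rule eq_if_buckets_eq[where J = "{..<m choose k} \<times> {1..r}", OF _ _ _ _ _ that])
    fix D \<sigma> assume emb: "algebraic_embedding D \<sigma>"
    obtain \<tau> \<rho> where g: "(\<tau>, \<rho>) \<in> carrier (sym_wreath m r)"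
      "\<And>A. A \<in> primitive_domain m r k \<Longrightarrow> \<sigma> (\<alpha> A) = \<alpha> (primitive_action m r k (\<tau>, \<rho>) A)"
      using L.\<alpha>_permuted[OF emb] by blast
    obtain \<tau>' \<rho>' where g': "(\<tau>', \<rho>') \<in> carrier (sym_wreath m r)"
      "\<And>A. A \<in> primitive_domain m r k \<Longrightarrow> \<sigma> (\<alpha>' A) = \<alpha>' (primitive_action m r k (\<tau>', \<rho>') A)"
      using L'.\<alpha>_permuted[OF emb] by blast
    have "bij_betw (map_prod id \<rho>) ({..<m choose k} \<times> {1..r}) ({..<m choose k} \<times> {1..r})"
      using g(1) by (intro bij_betw_map_prod) (auto simp: sym_wreath_carrier permutes_imp_bij)
    moreover have "\<sigma> (L.block_value t u (fst j) (snd j)) = L.block_value t u (fst (map_prod id \<rho> j)) (snd (map_prod id \<rho> j))"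
      "\<sigma> (L'.block_value t u (fst j) (snd j)) = L'.block_value t u (fst (map_prod id \<rho> j)) (snd (map_prod id \<rho> j))"
      if "j \<in> {..<m choose k} \<times> {1..r}" for j
      using that L.hom_block_value[OF emb g, of "snd j"] L'.hom_block_value[OF emb g', of "snd j"]
        same_block[OF emb g g', of "snd j"] by auto
    ultimately show "\<exists>\<pi>. bij_betw \<pi> ({..<m choose k} \<times> {1..r}) ({..<m choose k} \<times> {1..r}) \<and>
      (\<forall>j\<in>{..<m choose k} \<times> {1..r}.
        \<sigma> (L.block_value t u (fst j) (snd j)) = L.block_value t u (fst (\<pi> j)) (snd (\<pi> j)) \<and>
        \<sigma> (L'.block_value t u (fst j) (snd j)) = L'.block_value t u (fst (\<pi> j)) (snd (\<pi> j)))" by blast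
  next
    fix j assume j: "j \<in> {..<m choose k} \<times> {1..r}"
    show "bucket (L.block_value t u (fst j) (snd j)) = bucket (L'.block_value t u (fst j) (snd j))"
    proof (cases "fst j = 0")
      case True
      thus ?thesis using v0 j by auto
    next
      case False
      hence "j \<in> {1..<m choose k} \<times> {1..r}" using j by auto
      thus ?thesis using code' by (auto dest!: restrict_eqD[where j = j])
    qed
  qed (auto intro: L.block_value_algebraic_int L'.block_value_algebraic_int)
  have fibre: "L.fibre_poly t i = L'.fibre_poly t i" if "i \<in> {1..r}" for i
    unfolding L.fibre_poly_def L'.fibre_poly_def
  proof (rule monic_prod_eq_if_values_eq[OF finite_subsets_of_card, where u = u], unfold card_subsets_of_card)
    fix w assume "w < m choose k"
    thus "(\<Prod>a\<in>subsets_of_card m k. of_nat (u + w) - L.fibre_value t i a)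
      = (\<Prod>a\<in>subsets_of_card m k. of_nat (u + w) - L'.fibre_value t i a)"
      using v_eq[of "(w, i)"] that unfolding L.block_value_def L'.block_value_def by simp
  qed
  have fibre_value_eq: "L.fibre_value t i a = L'.fibre_value t i a" if i: "i \<in> {1..r}" and a: "a \<in> subsets_of_card m k" for i a
  proof (rule roots_eq_if_root_index_eq[OF finite_subsets_of_card a L.fibre_poly_def])
    show "L.fibre_poly t i = (\<Prod>a\<in>subsets_of_card m k. [:- L'.fibre_value t i a, 1:])"
      by (simp add: fibre[OF i] L'.fibre_poly_def)
    have "(i, a) \<in> {1..r} \<times> subsets_of_card m k" using i a by simp
    thus "root_index (L.fibre_poly t i) (L.fibre_value t i a) = root_index (L.fibre_poly t i) (L'.fibre_value t i a)"
      using code' fibre[OF i] by (auto dest!: restrict_eqD[where j = "(i, a)"])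
  qed
  show ?thesis
  proof (rule eq_if_buckets_eq[where J = "primitive_domain m r k", OF finite_primitive_domain _ _ _ _ A])
    fix D \<sigma> assume emb: "algebraic_embedding D \<sigma>"
    obtain \<tau> \<rho> where g: "(\<tau>, \<rho>) \<in> carrier (sym_wreath m r)"
      "\<And>A. A \<in> primitive_domain m r k \<Longrightarrow> \<sigma> (\<alpha> A) = \<alpha> (primitive_action m r k (\<tau>, \<rho>) A)"
      using L.\<alpha>_permuted[OF emb] by blast
    obtain \<tau>' \<rho>' where g': "(\<tau>', \<rho>') \<in> carrier (sym_wreath m r)"
      "\<And>A. A \<in> primitive_domain m r k \<Longrightarrow> \<sigma> (\<alpha>' A) = \<alpha>' (primitive_action m r k (\<tau>', \<rho>') A)"
      using L'.\<alpha>_permuted[OF emb] by blast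
    have image_eq: "\<tau> (\<rho> i) ` a = \<tau>' (\<rho> i) ` a" if i: "i \<in> {1..r}" and a: "a \<in> subsets_of_card m k" for i a
    proof -
      have \<rho>i: "\<rho> i \<in> {1..r}" using g(1) i permutes_in_image by (metis sym_wreath_carrier)
      have mem: "\<tau> (\<rho> i) ` a \<in> subsets_of_card m k" "\<tau>' (\<rho> i) ` a \<in> subsets_of_card m k"
        using bij_betwE[OF image_subsets_of_card[OF g(1) \<rho>i]] bij_betwE[OF image_subsets_of_card[OF g'(1) \<rho>i]] a
        by blast+
      have "L.fibre_value t (\<rho> i) (\<tau> (\<rho> i) ` a) = L.fibre_value t (\<rho> i) (\<tau>' (\<rho> i) ` a)"
        using L.hom_fibre_value[OF emb g i, of t a] L'.hom_fibre_value[OF emb g' i, of t a] fibre_value_eq[OF i a]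
          fibre_value_eq[OF \<rho>i mem(2)] same_block[OF emb g g' i] by simp
      thus ?thesis using inj_onD[OF fibre_value_inj, of "(\<rho> i, \<tau> (\<rho> i) ` a)" "(\<rho> i, \<tau>' (\<rho> i) ` a)"] \<rho>i mem by simp
    qed
    have act_eq: "primitive_action m r k (\<tau>, \<rho>) A = primitive_action m r k (\<tau>', \<rho>') A"
      if A: "A \<in> primitive_domain m r k" for A
    proof (rule extensionalityI[where A = "{1..r}"])
      show "primitive_action m r k (\<tau>, \<rho>) A \<in> extensional {1..r}" "primitive_action m r k (\<tau>', \<rho>') A \<in> extensional {1..r}"
        using A by (simp_all add: primitive_action_def)
      fix j assume "j \<in> {1..r}"
      moreover have "\<rho> permutes {1..r}" using g(1) by (simp add: sym_wreath_carrier)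
      ultimately obtain i where i: "i \<in> {1..r}" "j = \<rho> i" by (metis permutes_image imageE)
      have "A i \<in> subsets_of_card m k" using A i(1) by (auto simp: primitive_domain_def)
      thus "primitive_action m r k (\<tau>, \<rho>) A j = primitive_action m r k (\<tau>', \<rho>') A j"
        using primitive_action_at(2)[OF g(1) A i(1)] primitive_action_at(2)[OF g'(1) A i(1)]
          same_block[OF emb g g' i(1)] image_eq[OF i(1)] i(2) by simp
    qed
    show "\<exists>\<pi>. bij_betw \<pi> (primitive_domain m r k) (primitive_domain m r k) \<and>
      (\<forall>A\<in>primitive_domain m r k. \<sigma> (\<alpha> A) = \<alpha> (\<pi> A) \<and> \<sigma> (\<alpha>' A) = \<alpha>' (\<pi> A))"
      using bij_betw_primitive_action[OF g(1)] g(2) g'(2) act_eq by metis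
  next
    fix A assume "A \<in> primitive_domain m r k"
    thus "bucket (\<alpha> A) = bucket (\<alpha>' A)" using code' by (auto dest!: restrict_eqD[where j = A])
  qed (auto intro: L.\<alpha>_algebraic_int L'.\<alpha>_algebraic_int)
qed

section \<open>Counting the codes\<close>

definition code_space where
  "code_space m r k T U K1 K2 Y =
     {..T :: nat} \<times> {..U :: nat} \<times> ({..<r :: nat} \<rightarrow>\<^sub>E {- K1..K1 :: int}) \<times> ({1..r} \<rightarrow>\<^sub>E {..<r}) \<times>
     ({1..<m choose k} \<times> {1..r} \<rightarrow>\<^sub>E {- K2..K2 :: int}) \<times>
     ({1..r} \<times> subsets_of_card m k \<rightarrow>\<^sub>E {..<m choose k}) \<times>
     (Y :: ((nat \<Rightarrow> nat set) \<Rightarrow> int) set)"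

lemma finite_code_space:
  assumes "finite Y"
  shows "finite (code_space m r k T U K1 K2 Y)"
proof -
  have "finite ({1..r} \<times> subsets_of_card m k)" using finite_subsets_of_card by simp
  thus ?thesis unfolding code_space_def
    by (intro finite_cartesian_product finite_PiE assms) auto
qed

lemma card_code_space:
  assumes "K1 \<ge> 0" "K2 \<ge> 0"
  shows "real (card (code_space m r k T U K1 K2 Y)) =
    (real T + 1) * (real U + 1) * (2 * real_of_int K1 + 1) ^ r * real r ^ r *
    (2 * real_of_int K2 + 1) ^ (((m choose k) - 1) * r) * real (m choose k) ^ (r * (m choose k)) * card Y"
proof -
  have fin: "finite ({1..r} \<times> subsets_of_card m k)" using finite_subsets_of_card by simp
  have fin': "finite ({1..<m choose k} \<times> {1..r})" by simp
  have card_box: "real (card {- K..K}) = 2 * of_int K + 1" if "K \<ge> 0" for K :: int using that by simp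
  show ?thesis
    unfolding code_space_def card_cartesian_product card_PiE[OF fin] card_PiE[OF fin']
      card_PiE[OF finite_atLeastAtMost] card_PiE[OF finite_lessThan] prod_constant card_subsets_of_card
    by (simp add: card_box[OF assms(1)] card_box[OF assms(2)] algebra_simps del: card_atLeastAtMost_int)
qed

lemma (in wreath_labelling) labelling_code_in_code_space:
  assumes tu: "t \<le> T" "u \<le> U"
    and M: "(\<Prod>A\<in>primitive_domain m r k. max 1 (cmod (\<alpha> A))) \<le> M"
    and V: "(real (U + (m choose k)) + 1) ^ (m choose k) * (real T + 1) ^ ((m choose k) ^ r) * M \<le> V"
  shows "labelling_code t u \<in> code_space m r k T U \<lfloor>(real r + V) ^ r\<rfloor> \<lfloor>9 * max 1 V\<rfloor>
    {y \<in> primitive_domain m r k \<rightarrow>\<^sub>E UNIV.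
       (\<Prod>A\<in>primitive_domain m r k. max 1 \<bar>real_of_int (y A)\<bar>) \<le> 9 ^ ((m choose k) ^ r) * M}"
proof -
  let ?\<Omega> = "primitive_domain m r k" and ?S = "subsets_of_card m k" and ?N = "m choose k"
  have prod_ge1: "(\<Prod>A\<in>?\<Omega>. max 1 (cmod (\<alpha> A))) \<ge> 1" by (intro prod_ge_1) auto
  have norm_v: "cmod (block_value t u w i) \<le> V" if "i \<in> {1..r}" "w \<le> ?N" for w i
  proof -
    have "cmod (block_value t u w i) \<le> (real (u + w) + 1) ^ ?N * (real t + 1) ^ (?N ^ r)
      * (\<Prod>A\<in>?\<Omega>. max 1 (cmod (\<alpha> A)))" by (rule norm_block_value_le[OF that(1)])
    also have "\<dots> \<le> (real (U + ?N) + 1) ^ ?N * (real T + 1) ^ (?N ^ r) * M"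
      using tu that(2) M prod_ge1 by (intro mult_mono power_mono) auto
    finally show ?thesis using V by simp
  qed
  have part1: "\<lfloor>Re (\<Prod>i\<in>{1..r}. of_nat w - block_value t u 0 i)\<rfloor> \<in> {- \<lfloor>(real r + V) ^ r\<rfloor>..\<lfloor>(real r + V) ^ r\<rfloor>}"
    if "w < r" for w
  proof -
    let ?z = "\<Prod>i\<in>{1..r}. of_nat w - block_value t u 0 i"
    obtain n where n: "?z = of_int n" using norm_prod_values_in_Ints by (meson Ints_cases)
    have "cmod ?z \<le> (\<Prod>i\<in>{1..r}. real r + V)"
      unfolding prod_norm[symmetric]
    proof (intro prod_mono conjI)
      fix i assume "i \<in> {1..r}"
      hence "cmod (block_value t u 0 i) \<le> V" using norm_v by simp
      thus "cmod (of_nat w - block_value t u 0 i) \<le> real r + V"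
        using norm_triangle_ineq4[of "of_nat w :: complex" "block_value t u 0 i"] that by simp
    qed simp
    hence "real_of_int \<bar>n\<bar> \<le> (real r + V) ^ r" unfolding n by simp
    hence "\<bar>n\<bar> \<le> \<lfloor>(real r + V) ^ r\<rfloor>" by (simp only: le_floor_iff)
    thus ?thesis unfolding n by (simp add: abs_le_iff minus_le_iff)
  qed
  have root_index_less: "root_index (\<Prod>j\<in>J. [:- f j, 1:]) (f j) < card J"
    if "finite J" "j \<in> J" for J :: "'j set" and f :: "'j \<Rightarrow> complex" and j
  proof -
    let ?p = "\<Prod>j\<in>J. [:- f j, 1:]"
    have "?p \<noteq> 0" using that(1) by auto
    moreover have "poly ?p (f j) = 0" unfolding poly_linear_prod using that by auto
    ultimately have "root_index ?p (f j) < Polynomial.degree ?p" by (rule root_index(2))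
    thus ?thesis by (simp only: degree_linear_prod[OF that(1)])
  qed
  have part2: "root_index (block_poly t u) (block_value t u 0 i) \<in> {..<r}" if "i \<in> {1..r}" for i
    using root_index_less[OF finite_atLeastAtMost that, of "block_value t u 0"] by (simp add: block_poly_def)
  have part3: "bucket (block_value t u w i) \<in> {- \<lfloor>9 * max 1 V\<rfloor>..\<lfloor>9 * max 1 V\<rfloor>}"
    if "w \<in> {1..<?N}" "i \<in> {1..r}" for w i
  proof -
    have "cmod (block_value t u w i) \<le> V" using norm_v that by simp
    hence "real_of_int \<bar>bucket (block_value t u w i)\<bar> \<le> 9 * max 1 V"
      using bucket_bound[of "block_value t u w i"] by (simp add: max_def split: if_splits)
    hence "\<bar>bucket (block_value t u w i)\<bar> \<le> \<lfloor>9 * max 1 V\<rfloor>" by (simp only: le_floor_iff)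
    thus ?thesis by (simp add: abs_le_iff minus_le_iff)
  qed
  have part4: "root_index (fibre_poly t i) (fibre_value t i a) \<in> {..<?N}" if "a \<in> ?S" for i a
    using root_index_less[OF finite_subsets_of_card that, of "fibre_value t i"]
    unfolding fibre_poly_def card_subsets_of_card by simp
  have "(\<Prod>A\<in>?\<Omega>. max 1 \<bar>real_of_int (bucket (\<alpha> A))\<bar>) \<le> (\<Prod>A\<in>?\<Omega>. 9 * max 1 (cmod (\<alpha> A)))"
    using bucket_bound by (intro prod_mono) (auto simp: max_def)
  also have "\<dots> = 9 ^ (?N ^ r) * (\<Prod>A\<in>?\<Omega>. max 1 (cmod (\<alpha> A)))"
    unfolding prod.distrib prod_constant card_primitive_domain ..
  also have "\<dots> \<le> 9 ^ (?N ^ r) * M" using M by simp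
  finally have part5: "(\<Prod>A\<in>?\<Omega>. max 1 \<bar>real_of_int (bucket (\<alpha> A))\<bar>) \<le> 9 ^ (?N ^ r) * M" .
  hence part5': "(\<Prod>A\<in>?\<Omega>. max 1 \<bar>real_of_int (restrict (\<lambda>A. bucket (\<alpha> A)) ?\<Omega> A)\<bar>) \<le> 9 ^ (?N ^ r) * M"
    by (simp cong: prod.cong)
  show ?thesis
    unfolding labelling_code_def code_space_def mem_Times_iff fst_conv snd_conv
  proof (intro conjI)
    show "restrict (\<lambda>A. bucket (\<alpha> A)) ?\<Omega> \<in> {y \<in> ?\<Omega> \<rightarrow>\<^sub>E UNIV.
       (\<Prod>A\<in>?\<Omega>. max 1 \<bar>real_of_int (y A)\<bar>) \<le> 9 ^ ((m choose k) ^ r) * M}"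
      using part5' by simp
  qed (use tu part1 part2 part3 part4 in \<open>auto intro!: restrict_PiE_iff[THEN iffD2] ballI\<close>)
qed

lemma wreath_labelling_exists:
  assumes G: "subgroup G (sym_wreath m r)"
    and f: "f \<in> polys_with_group H ((sym_wreath m r)\<lparr>carrier := G\<rparr>)
      (primitive_action m r k) (primitive_domain m r k)"
  shows "\<exists>\<alpha>. wreath_labelling m r k \<alpha> \<and> bij_betw \<alpha> (primitive_domain m r k) (root_set f)"
proof -
  obtain \<alpha> where \<alpha>: "bij_betw \<alpha> (primitive_domain m r k) (root_set f)"
    and perm: "\<And>D \<sigma>. algebraic_embedding D \<sigma> \<Longrightarrow> \<exists>g\<in>G. \<forall>A\<in>primitive_domain m r k.
      \<sigma> (\<alpha> A) = \<alpha> (primitive_action m r k g A)"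
    using labelled_roots_permuted_by_group[OF f] by force
  have "wreath_labelling m r k \<alpha>"
  proof
    fix A assume "A \<in> primitive_domain m r k"
    hence "\<alpha> A \<in> root_set f" using \<alpha> bij_betwE by blast
    thus "algebraic_int (\<alpha> A)"
      using f by (auto simp: root_set_def algebraic_int_altdef_ipoly polys_with_group_def monic_polys_def)
  next
    fix D \<sigma> assume "algebraic_embedding D \<sigma>"
    then obtain g where "g \<in> G" "\<forall>A\<in>primitive_domain m r k. \<sigma> (\<alpha> A) = \<alpha> (primitive_action m r k g A)"
      using perm by blast
    thus "\<exists>\<tau> \<rho>. (\<tau>, \<rho>) \<in> carrier (sym_wreath m r) \<and>
      (\<forall>A\<in>primitive_domain m r k. \<sigma> (\<alpha> A) = \<alpha> (primitive_action m r k (\<tau>, \<rho>) A))"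
      using subgroup.subset[OF G] by (cases g) blast
  qed
  thus ?thesis using \<alpha> by blast
qed

text \<open>A polynomial is determined by its roots, these by the code of a labelling; the bounds \<open>T\<close>
  and \<open>U\<close> for the separating parameters depend on the degree only, and \<open>M\<close> is the bound of
  Landau for the Mahler measure.\<close>
lemma card_polys_with_group_le_code_space:
  fixes m r k :: nat and H :: real
  defines "N \<equiv> m choose k"
  defines "T \<equiv> (r * N)\<^sup>2 * N ^ r" and "U \<equiv> r\<^sup>2 * N" and "M \<equiv> sqrt (real (N ^ r) + 1) * H"
  defines "V \<equiv> (real (U + N) + 1) ^ N * (real T + 1) ^ (N ^ r) * M"
  defines "Y \<equiv> {y \<in> primitive_domain m r k \<rightarrow>\<^sub>E UNIV.
    (\<Prod>A\<in>primitive_domain m r k. max 1 \<bar>real_of_int (y A)\<bar>) \<le> 9 ^ (N ^ r) * M}"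
  assumes G: "subgroup G (sym_wreath m r)" and "N \<ge> 2" and "H \<ge> 1" and "finite Y"
  shows "card (polys_with_group H ((sym_wreath m r)\<lparr>carrier := G\<rparr>)
      (primitive_action m r k) (primitive_domain m r k))
    \<le> card (code_space m r k T U \<lfloor>(real r + V) ^ r\<rfloor> \<lfloor>9 * max 1 V\<rfloor> Y)"
    (is "card ?F \<le> card ?K")
proof -
  let ?\<Omega> = "primitive_domain m r k"
  define P where "P = (\<lambda>f (\<alpha>, t, u). wreath_labelling m r k \<alpha> \<and> bij_betw \<alpha> ?\<Omega> (root_set f) \<and> t \<le> T \<and> u \<le> U \<and>
    inj_on (\<lambda>(i, a). wreath_labelling.fibre_value m r k \<alpha> t i a) ({1..r} \<times> subsets_of_card m k) \<and>
    inj_on (wreath_labelling.block_value m r k \<alpha> t u 0) {1..r})"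
  have "\<exists>l. P f l" if f: "f \<in> ?F" for f
  proof -
    obtain \<alpha> where \<alpha>: "wreath_labelling m r k \<alpha>" "bij_betw \<alpha> ?\<Omega> (root_set f)"
      using wreath_labelling_exists[OF G f] by blast
    interpret wreath_labelling m r k \<alpha> by (rule \<alpha>(1))
    obtain t where t: "t \<le> T" "inj_on (\<lambda>(i, a). fibre_value t i a) ({1..r} \<times> subsets_of_card m k)"
      using fibre_value_separated[OF bij_betw_imp_inj_on[OF \<alpha>(2)]] \<open>N \<ge> 2\<close> by (auto simp: T_def N_def)
    obtain u where "u \<le> U" "inj_on (block_value t u 0) {1..r}"
      using block_value_separated[OF t(2)] \<open>N \<ge> 2\<close> by (auto simp: U_def N_def)
    thus ?thesis using \<alpha> t by (intro exI[of _ "(\<alpha>, t, u)"]) (simp add: P_def)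
  qed
  hence "\<exists>l. \<forall>f\<in>?F. P f (l f)" by (intro bchoice) blast
  then obtain l where l: "\<And>f. f \<in> ?F \<Longrightarrow> P f (l f)" by blast
  define c where "c = (\<lambda>f. case l f of (\<alpha>, t, u) \<Rightarrow> wreath_labelling.labelling_code m r k \<alpha> t u)"
  have f: "f \<in> monic_polys (N ^ r) H" "Defs.separable f" if "f \<in> ?F" for f
    using that by (auto simp: polys_with_group_def card_primitive_domain N_def)
  have "inj_on c ?F"
  proof (rule inj_onI)
    fix f f' assume ff: "f \<in> ?F" "f' \<in> ?F" "c f = c f'"
    obtain \<alpha> t u \<alpha>' t' u' where lf: "l f = (\<alpha>, t, u)" "l f' = (\<alpha>', t', u')" by (cases "l f"; cases "l f'") auto
    have P: "P f (\<alpha>, t, u)" "P f' (\<alpha>', t', u')" using l[OF ff(1)] l[OF ff(2)] lf by simp_all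
    have "\<alpha> A = \<alpha>' A" if "A \<in> ?\<Omega>" for A
      using labelling_eq_if_labelling_code_eq[of m r k \<alpha> \<alpha>' t u t' u' A] P ff(3) lf that
      by (simp add: P_def c_def)
    hence "\<alpha> ` ?\<Omega> = \<alpha>' ` ?\<Omega>" by (intro image_cong) auto
    hence "root_set f = root_set f'" using P by (simp add: P_def bij_betw_def)
    hence "map_poly of_int f = (map_poly of_int f' :: complex poly)"
      using complex_poly_eq_prod_roots[OF f[OF ff(1)]] complex_poly_eq_prod_roots[OF f[OF ff(2)]] by simp
    thus "f = f'" by simp
  qed
  moreover have "c ` ?F \<subseteq> ?K"
  proof
    fix x assume "x \<in> c ` ?F"
    then obtain f' where f': "f' \<in> ?F" "x = c f'" by blast
    obtain \<alpha> t u where lf: "l f' = (\<alpha>, t, u)" by (cases "l f'") auto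
    have P: "P f' (\<alpha>, t, u)" using l[OF f'(1)] lf by simp
    interpret wreath_labelling m r k \<alpha> using P by (simp add: P_def)
    have "(\<Prod>A\<in>?\<Omega>. max 1 (cmod (\<alpha> A))) = (\<Prod>z\<in>root_set f'. max 1 (cmod z))"
      by (rule prod.reindex_bij_betw) (use P in \<open>simp add: P_def\<close>)
    also have "\<dots> \<le> M" using mahler_measure_separable_le[OF f[OF f'(1)] \<open>H \<ge> 1\<close>] by (simp add: M_def)
    finally have M: "(\<Prod>A\<in>?\<Omega>. max 1 (cmod (\<alpha> A))) \<le> M" .
    have "labelling_code t u \<in> ?K"
      unfolding Y_def N_def
      by (rule labelling_code_in_code_space[OF _ _ M]) (use P in \<open>simp_all add: P_def V_def N_def\<close>)
    thus "x \<in> ?K" using f' lf by (simp add: c_def)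
  qed
  ultimately show ?thesis using finite_code_space[OF \<open>finite Y\<close>] by (rule card_inj_on_le)
qed

theorem theorem1p1:
  fixes \<epsilon> :: real and m r k :: nat
    and G :: "((nat \<Rightarrow> nat \<Rightarrow> nat) \<times> (nat \<Rightarrow> nat)) set"
  assumes "\<epsilon> > 0" and "m \<ge> 2" and "r \<ge> 2" and "1 \<le> k" and "real k \<le> real m / 2"
    and "nonelemental_group r m k G"
  shows "\<exists>C>0. \<forall>H\<ge>1.
    real (card (polys_with_group H ((sym_wreath m r)\<lparr>carrier := G\<rparr>)
                  (primitive_action m r k) (primitive_domain m r k)))
      \<le> C * H powr (real r * (real (m choose k) + real r - 1) + 1 + \<epsilon>)"
proof -
  define N where "N = m choose k"
  define T where "T = (r * N)\<^sup>2 * N ^ r"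
  define U where "U = r\<^sup>2 * N"
  define q where "q = sqrt (real (N ^ r) + 1)"
  define b where "b = (real (U + N) + 1) ^ N * (real T + 1) ^ (N ^ r) * q"
  let ?\<Omega> = "primitive_domain m r k"
  have "m choose k \<ge> m choose 1"
    by (rule binomial_mono) (use assms in linarith)+
  hence N2: "N \<ge> 2" using \<open>m \<ge> 2\<close> by (simp add: N_def)
  have q1: "q \<ge> 1" by (simp add: q_def)
  have b1: "b \<ge> 1" unfolding b_def
    by (intro mult_ge1_I one_le_power q1) auto
  have G: "subgroup G (sym_wreath m r)" using assms(6) by (simp add: nonelemental_group_def)
  obtain Z where Z: "Z > 0" and Z_bound: "\<And>B. B \<ge> 1 \<Longrightarrow>
      finite {y \<in> ?\<Omega> \<rightarrow>\<^sub>E UNIV. (\<Prod>A\<in>?\<Omega>. max 1 \<bar>real_of_int (y A)\<bar>) \<le> B} \<and>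
      real (card {y \<in> ?\<Omega> \<rightarrow>\<^sub>E UNIV. (\<Prod>A\<in>?\<Omega>. max 1 \<bar>real_of_int (y A)\<bar>) \<le> B}) \<le> Z * B powr (1 + \<epsilon>)"
    using card_bounded_height_product[of "1 + \<epsilon>" ?\<Omega>] finite_primitive_domain[of m r k] assms(1) by auto
  \<comment> \<open>The factors \<open>3\<close> and \<open>27 = 3 * 9\<close> absorb the summand \<open>1\<close> in the sizes \<open>2 * K + 1\<close> of the boxes and
    the factor \<open>9\<close> of \<open>bucket_bound\<close>.\<close>
  define C where "C = (real T + 1) * (real U + 1) * (3 * (real r + b) ^ r) ^ r * real r ^ r *
    (27 * b) ^ ((N - 1) * r) * real N ^ (r * N) * (Z * (9 ^ (N ^ r) * q) powr (1 + \<epsilon>))"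
  have C0: "C > 0" unfolding C_def
    using Z b1 q1 N2 \<open>r \<ge> 2\<close> by (intro mult_pos_pos zero_less_power) auto
  have "real (card (polys_with_group H ((sym_wreath m r)\<lparr>carrier := G\<rparr>) (primitive_action m r k) ?\<Omega>))
      \<le> C * H powr (real r * (real N + real r - 1) + 1 + \<epsilon>)" if H: "H \<ge> 1" for H
  proof -
    define Y where "Y = {y \<in> ?\<Omega> \<rightarrow>\<^sub>E UNIV. (\<Prod>A\<in>?\<Omega>. max 1 \<bar>real_of_int (y A)\<bar>) \<le> 9 ^ (N ^ r) * (q * H)}"
    let ?V = "b * H"
    define K1 where "K1 = \<lfloor>(real r + ?V) ^ r\<rfloor>"
    define K2 where "K2 = \<lfloor>9 * max 1 ?V\<rfloor>"
    have V1: "?V \<ge> 1" using b1 H by (rule mult_ge1_I)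
    have B1: "9 ^ (N ^ r) * (q * H) \<ge> 1" using q1 H by (intro mult_ge1_I one_le_power) auto
    have Y: "finite Y" "real (card Y) \<le> Z * (9 ^ (N ^ r) * (q * H)) powr (1 + \<epsilon>)"
      using Z_bound[OF B1] by (simp_all add: Y_def)
    have K1: "K1 \<ge> 0" "2 * real_of_int K1 + 1 \<le> 3 * (real r + b) ^ r * H ^ r"
    proof -
      have ge1: "(real r + ?V) ^ r \<ge> 1" using V1 by (intro one_le_power) linarith
      thus "K1 \<ge> 0" by (simp add: K1_def)
      have "real r + ?V \<le> (real r + b) * H" using mult_left_mono[OF H, of "real r"] by (simp add: algebra_simps)
      hence "(real r + ?V) ^ r \<le> ((real r + b) * H) ^ r" using V1 by (intro power_mono) auto
      moreover have "2 * real_of_int K1 + 1 \<le> 3 * (real r + ?V) ^ r"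
        using ge1 of_int_floor_le[of "(real r + ?V) ^ r"] unfolding K1_def by linarith
      ultimately show "2 * real_of_int K1 + 1 \<le> 3 * (real r + b) ^ r * H ^ r"
        by (simp add: power_mult_distrib)
    qed
    have K2: "K2 \<ge> 0" "2 * real_of_int K2 + 1 \<le> 27 * b * H"
    proof -
      show "K2 \<ge> 0" by (simp add: K2_def)
      have "real_of_int K2 \<le> 9 * ?V" using V1 of_int_floor_le[of "9 * max 1 ?V"] by (simp add: K2_def)
      thus "2 * real_of_int K2 + 1 \<le> 27 * b * H" using V1 by linarith
    qed
    have "card (polys_with_group H ((sym_wreath m r)\<lparr>carrier := G\<rparr>) (primitive_action m r k) ?\<Omega>)
        \<le> card (code_space m r k T U K1 K2 Y)"
      using card_polys_with_group_le_code_space[OF G, of k H] N2 H Y(1)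
      unfolding K1_def K2_def Y_def N_def T_def U_def q_def b_def by (simp add: mult.assoc)
    hence "real (card (polys_with_group H ((sym_wreath m r)\<lparr>carrier := G\<rparr>) (primitive_action m r k) ?\<Omega>))
        \<le> real (card (code_space m r k T U K1 K2 Y))" by simp
    also have "\<dots> = (real T + 1) * (real U + 1) * (2 * real_of_int K1 + 1) ^ r * real r ^ r *
        (2 * real_of_int K2 + 1) ^ ((N - 1) * r) * real N ^ (r * N) * card Y"
      unfolding N_def by (rule card_code_space[OF K1(1) K2(1)])
    also have "\<dots> \<le> (real T + 1) * (real U + 1) * (3 * (real r + b) ^ r * H ^ r) ^ r * real r ^ r *
        (27 * b * H) ^ ((N - 1) * r) * real N ^ (r * N) * (Z * (9 ^ (N ^ r) * (q * H)) powr (1 + \<epsilon>))"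
      using K1 K2 Y(2) b1 H by (intro mult_mono power_mono mult_nonneg_nonneg zero_le_power) auto
    also have "\<dots> = C * ((H ^ r) ^ r * H ^ ((N - 1) * r) * H powr (1 + \<epsilon>))"
      using q1 H by (simp add: C_def power_mult_distrib powr_mult flip: mult.assoc) 
    also have "(H ^ r) ^ r * H ^ ((N - 1) * r) * H powr (1 + \<epsilon>)
        = H powr (real r * (real N + real r - 1) + 1 + \<epsilon>)"
    proof -
      have "real ((N - 1) * r) = (real N - 1) * real r" using N2 by (simp add: of_nat_diff)
      hence "real (r * r) + real ((N - 1) * r) + (1 + \<epsilon>) = real r * (real N + real r - 1) + 1 + \<epsilon>"
        by (simp add: algebra_simps)
      moreover have "H ^ e = H powr real e" for e using H by (simp add: powr_realpow)
      hence "(H ^ r) ^ r * H ^ ((N - 1) * r) = H powr (real (r * r) + real ((N - 1) * r))"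
        unfolding power_mult[symmetric] powr_add by simp
      ultimately show ?thesis by (simp add: add.assoc flip: powr_add)
    qed
    finally show ?thesis .
  qed
  thus ?thesis using C0 unfolding N_def by blast
qed

end
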